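(* Let $\mathcal{Q}$ be a small quantaloid and let $F:\mathbb{A}\to\mathbb{B}$ be a functor between $\mathcal{Q}$-categories. Then $F$ has a pointwise left Kan extension along the Yoneda embedding $Y_{\mathbb{A}}:\mathbb{A}\to\mathcal{P}\mathbb{A}$ if and only if, for every contravariant presheaf $\phi\in\mathcal{P}\mathbb{A}$, the $\phi$-weighted colimit of $F$ exists. In this case, $\langle F,Y_{\mathbb{A}}\rangle:\mathcal{P}\mathbb{A}\to\mathbb{B}$ is left adjoint to $\langle Y_{\mathbb{A}},F\rangle:\mathbb{B}\to\mathcal{P}\mathbb{A}$, and $\langle F,Y_{\mathbb{A}}\rangle\circ Y_{\mathbb{A}}\cong F$. Moreover, $\langle F,Y_{\mathbb{A}}\rangle$ is then the essentially unique cocontinuous factorization of $F$ through $Y_{\mathbb{A}}$: it is cocontinuous, and every cocontinuous functor $G:\mathcal{P}\mathbb{A}\to\mathbb{B}$ with $G\circ Y_{\mathbb{A}}\cong F$ satisfies $G\cong\langle F,Y_{\mathbb{A}}\rangle$.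
   Context: A sup-lattice is a partially ordered set in which every subset has a supremum. A quantaloid $\mathcal{Q}$ is a category whose hom-sets are sup-lattices and whose composition preserves arbitrary suprema in each variable; it is small if its objects form a set. In any quantaloid, for $g:B\to C$ and $h:A\to C$, $[g,h]:A\to B$ denotes the largest $x$ with $g\circ x\leq h$. A $\mathcal{Q}$-category $\mathbb{A}$ is a set $\mathbb{A}_0$ of objects, each $a$ having a type $ta\in\mathcal{Q}$, with arrows $\mathbb{A}(a',a):ta\to ta'$ in $\mathcal{Q}$ such that $\mathbb{A}(a'',a')\circ\mathbb{A}(a',a)\leq\mathbb{A}(a'',a)$ and $1_{ta}\leq\mathbb{A}(a,a)$. A distributor $\Phi:\mathbb{A}\nrightarrow\mathbb{B}$ is a family of arrows $\Phi(b,a):ta\to tb$ with $\mathbb{B}(b',b)\circ\Phi(b,a)\leq\Phi(b',a)$ and $\Phi(b,a)\circ\mathbb{A}(a,a')\leq\Phi(b,a')$. A functor $F:\mathbb{A}\to\mathbb{B}$ is a map $\mathbb{A}_0\to\mathbb{B}_0$ with $t(Fa)=ta$ and $\mathbb{A}(a',a)\leq\mathbb{B}(Fa',Fa)$. $\mathcal{Q}$-categories and distributors form a quantaloid $\mathsf{Dist}(\mathcal{Q})$ with composition $(\Psi\otimes_{\mathbb{B}}\Phi)(c,a)=\bigvee_{b}\Psi(c,b)\circ\Phi(b,a)$, identities $\mathbb{A}:\mathbb{A}\nrightarrow\mathbb{A}$ (the hom-arrows), and elementwise order; $[-,-]$ is also used in $\mathsf{Dist}(\mathcal{Q})$. A functor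 $F:\mathbb{A}\to\mathbb{B}$ induces distributors $\mathbb{B}(-,F-):\mathbb{A}\nrightarrow\mathbb{B}$ and $\mathbb{B}(F-,-):\mathbb{B}\nrightarrow\mathbb{A}$. For functors $F,G:\mathbb{A}\to\mathbb{B}$ put $F\leq G$ iff $1_{ta}\leq\mathbb{B}(Fa,Ga)$ for all $a$ (equivalently $\mathbb{B}(-,F-)\leq\mathbb{B}(-,G-)$), and $F\cong G$ iff $F\leq G\leq F$; this makes $\mathcal{Q}$-categories and functors a locally ordered 2-category $\mathsf{Cat}(\mathcal{Q})$. $F:\mathbb{A}\to\mathbb{B}$ is left adjoint to $G:\mathbb{B}\to\mathbb{A}$ if $1_{\mathbb{A}}\leq G\circ F$ and $F\circ G\leq 1_{\mathbb{B}}$. For $C\in\mathcal{Q}$, $*_C$ is the one-object $\mathcal{Q}$-category of type $C$ with hom-arrow $1_C$. For $\Theta:\mathbb{C}\nrightarrow\mathbb{A}$ and $F:\mathbb{A}\to\mathbb{B}$, the $\Theta$-weighted colimit of $F$ is, if it exists, a functor $\mathrm{colim}(\Theta,F):\mathbb{C}\to\mathbb{B}$ with $\mathbb{B}(\mathrm{colim}(\Theta,F)-,-)=[\Theta,\mathbb{B}(F-,-)]$. A functor $F'$ on $\mathbb{B}$ is cocontinuous if for every $\Theta$ and $F$ such that $\mathrm{colim}(\Theta,F)$ exists in $\mathbb{B}$, $\mathrm{colim}(\Theta,F'\circ F)$ exists and is isomorphic to $F'\circ\mathrm{colim}(\Theta,F)$. The left Kan extension $\langle F,G\rangle:\mathbb{C}\to\mathbb{B}$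 of $F:\mathbb{A}\to\mathbb{B}$ along $G:\mathbb{A}\to\mathbb{C}$ is, if it exists, a functor $K$ with $F\leq K\circ G$ such that $F\leq K'\circ G$ implies $K\leq K'$ for all $K':\mathbb{C}\to\mathbb{B}$. It is pointwise if $\mathrm{colim}(\mathbb{C}(G-,-),F)$ exists, in which case $\langle F,G\rangle\cong\mathrm{colim}(\mathbb{C}(G-,-),F)$. $\mathcal{P}\mathbb{A}$ is the $\mathcal{Q}$-category whose objects of type $C$ are the distributors (contravariant presheaves) $\phi:*_C\nrightarrow\mathbb{A}$, with $\mathcal{P}\mathbb{A}(\psi,\phi)$ the single element of $[\psi,\phi]$; $Y_{\mathbb{A}}:\mathbb{A}\to\mathcal{P}\mathbb{A}$ sends $a$ to $\mathbb{A}(-,a):*_{ta}\nrightarrow\mathbb{A}$. *)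

theory Defs
  imports "HOL-Algebra.Lattice" "HOL-Library.FuncSet"
begin

section \<open>Quantaloids\<close>

locale sup_lattice = partial_order +
  assumes sup_exists: "S \<subseteq> carrier L \<Longrightarrow> \<exists>s. least L s (Upper L S)"

text \<open>
  \<^term>\<open>Comp Q A B C g f\<close> is the composite of \<open>f : A \<rightarrow> B\<close> and \<open>g : B \<rightarrow> C\<close>. The hom-sets of a
  quantaloid need not be disjoint, which is why composition and identities are indexed by objects.
\<close>

record ('o, 'm) quantaloid =
  Obj :: "'o set"
  Hom :: "'o \<Rightarrow> 'o \<Rightarrow> 'm gorder"
  Comp :: "'o \<Rightarrow> 'o \<Rightarrow> 'o \<Rightarrow> 'm \<Rightarrow> 'm \<Rightarrow> 'm"
  Id :: "'o \<Rightarrow> 'm"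

locale quantaloid =
  fixes Q :: "('o, 'm) quantaloid"
  assumes hom_sup_lattice:
      "\<lbrakk>A \<in> Obj Q; B \<in> Obj Q\<rbrakk> \<Longrightarrow> sup_lattice (Hom Q A B)"
    and Id_closed:
      "A \<in> Obj Q \<Longrightarrow> Id Q A \<in> carrier (Hom Q A A)"
    and Comp_closed:
      "\<lbrakk>A \<in> Obj Q; B \<in> Obj Q; C \<in> Obj Q; f \<in> carrier (Hom Q A B); g \<in> carrier (Hom Q B C)\<rbrakk>
        \<Longrightarrow> Comp Q A B C g f \<in> carrier (Hom Q A C)"
    and Comp_assoc:
      "\<lbrakk>A \<in> Obj Q; B \<in> Obj Q; C \<in> Obj Q; D \<in> Obj Q;
        f \<in> carrier (Hom Q A B); g \<in> carrier (Hom Q B C); h \<in> carrier (Hom Q C D)\<rbrakk>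
        \<Longrightarrow> Comp Q A C D h (Comp Q A B C g f) = Comp Q A B D (Comp Q B C D h g) f"
    and Comp_Id_right:
      "\<lbrakk>A \<in> Obj Q; B \<in> Obj Q; f \<in> carrier (Hom Q A B)\<rbrakk> \<Longrightarrow> Comp Q A A B f (Id Q A) = f"
    and Comp_Id_left:
      "\<lbrakk>A \<in> Obj Q; B \<in> Obj Q; f \<in> carrier (Hom Q A B)\<rbrakk> \<Longrightarrow> Comp Q A B B (Id Q B) f = f"
    and Comp_Sup_right:
      "\<lbrakk>A \<in> Obj Q; B \<in> Obj Q; C \<in> Obj Q; S \<subseteq> carrier (Hom Q A B); g \<in> carrier (Hom Q B C)\<rbrakk>
        \<Longrightarrow> Comp Q A B C g (\<Squnion>\<^bsub>Hom Q A B\<^esub> S) = \<Squnion>\<^bsub>Hom Q A C\<^esub> ((\<lambda>f. Comp Q A B C g f) ` S)"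
    and Comp_Sup_left:
      "\<lbrakk>A \<in> Obj Q; B \<in> Obj Q; C \<in> Obj Q; f \<in> carrier (Hom Q A B); S \<subseteq> carrier (Hom Q B C)\<rbrakk>
        \<Longrightarrow> Comp Q A B C (\<Squnion>\<^bsub>Hom Q B C\<^esub> S) f = \<Squnion>\<^bsub>Hom Q A C\<^esub> ((\<lambda>g. Comp Q A B C g f) ` S)"


section \<open>Categories, functors and distributors enriched in a quantaloid\<close>

text \<open>\<^term>\<open>hom A a' a\<close> is the arrow \<open>A(a',a) : ta \<rightarrow> ta'\<close>.\<close>

record ('a, 'o, 'm) qcat =
  objs :: "'a set"
  ty :: "'a \<Rightarrow> 'o"
  hom :: "'a \<Rightarrow> 'a \<Rightarrow> 'm"

locale qcategory = quantaloid Q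
  for Q :: "('o, 'm) quantaloid" and A :: "('a, 'o, 'm) qcat" +
  assumes ty_closed:
      "a \<in> objs A \<Longrightarrow> ty A a \<in> Obj Q"
    and hom_closed:
      "\<lbrakk>a \<in> objs A; a' \<in> objs A\<rbrakk> \<Longrightarrow> hom A a' a \<in> carrier (Hom Q (ty A a) (ty A a'))"
    and hom_comp:
      "\<lbrakk>a \<in> objs A; a' \<in> objs A; a'' \<in> objs A\<rbrakk>
        \<Longrightarrow> Comp Q (ty A a) (ty A a') (ty A a'') (hom A a'' a') (hom A a' a)
              \<sqsubseteq>\<^bsub>Hom Q (ty A a) (ty A a'')\<^esub> hom A a'' a"
    and hom_unit:
      "a \<in> objs A \<Longrightarrow> Id Q (ty A a) \<sqsubseteq>\<^bsub>Hom Q (ty A a) (ty A a)\<^esub> hom A a a"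

locale qfunctor = dom: qcategory Q A + cod: qcategory Q B
  for Q :: "('o, 'm) quantaloid" and A :: "('a, 'o, 'm) qcat" and B :: "('b, 'o, 'm) qcat" +
  fixes F :: "'a \<Rightarrow> 'b"
  assumes maps_objs: "F \<in> objs A \<rightarrow> objs B"
    and ty_preserving: "a \<in> objs A \<Longrightarrow> ty B (F a) = ty A a"
    and hom_le:
      "\<lbrakk>a \<in> objs A; a' \<in> objs A\<rbrakk>
        \<Longrightarrow> hom A a' a \<sqsubseteq>\<^bsub>Hom Q (ty A a) (ty A a')\<^esub> hom B (F a') (F a)"

text \<open>
  A distributor from \<open>A\<close> to \<open>B\<close> is a family of arrows \<open>\<Phi>(b,a) : ta \<rightarrow> tb\<close>. It is taken to be an
  extensional function on \<^term>\<open>objs B \<times> objs A\<close>, so that equality of distributors (and hence of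
  presheaves, which are the objects of \<open>PSh\<close> below) is elementwise equality.
\<close>

locale distributor = dom: qcategory Q A + cod: qcategory Q B
  for Q :: "('o, 'm) quantaloid" and A :: "('a, 'o, 'm) qcat" and B :: "('b, 'o, 'm) qcat" +
  fixes \<Phi> :: "'b \<times> 'a \<Rightarrow> 'm"
  assumes family:
      "\<Phi> \<in> (\<Pi>\<^sub>E (b, a) \<in> objs B \<times> objs A. carrier (Hom Q (ty A a) (ty B b)))"
    and left_action:
      "\<lbrakk>a \<in> objs A; b \<in> objs B; b' \<in> objs B\<rbrakk>
        \<Longrightarrow> Comp Q (ty A a) (ty B b) (ty B b') (hom B b' b) (\<Phi> (b, a))
              \<sqsubseteq>\<^bsub>Hom Q (ty A a) (ty B b')\<^esub> \<Phi> (b', a)"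
    and right_action:
      "\<lbrakk>a \<in> objs A; a' \<in> objs A; b \<in> objs B\<rbrakk>
        \<Longrightarrow> Comp Q (ty A a') (ty A a) (ty B b) (\<Phi> (b, a)) (hom A a a')
              \<sqsubseteq>\<^bsub>Hom Q (ty A a') (ty B b)\<^esub> \<Phi> (b, a')"

definition Dist ::
  "('o, 'm) quantaloid \<Rightarrow> ('a, 'o, 'm) qcat \<Rightarrow> ('b, 'o, 'm) qcat \<Rightarrow> ('b \<times> 'a \<Rightarrow> 'm) gorder"
  where "Dist Q A B =
    \<lparr>carrier = {\<Phi>. distributor Q A B \<Phi>},
     eq = (=),
     le = (\<lambda>\<Phi> \<Psi>. \<forall>a\<in>objs A. \<forall>b\<in>objs B. \<Phi> (b, a) \<sqsubseteq>\<^bsub>Hom Q (ty A a) (ty B b)\<^esub> \<Psi> (b, a))\<rparr>"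

text \<open>\<^term>\<open>dist_comp Q A B C \<Psi> \<Phi>\<close> is \<open>\<Psi> \<otimes>\<^sub>B \<Phi>\<close>, for \<open>\<Phi>\<close> from \<open>A\<close> to \<open>B\<close> and \<open>\<Psi>\<close> from \<open>B\<close> to \<open>C\<close>.\<close>

definition dist_comp ::
  "('o, 'm) quantaloid \<Rightarrow> ('a, 'o, 'm) qcat \<Rightarrow> ('b, 'o, 'm) qcat \<Rightarrow> ('c, 'o, 'm) qcat
    \<Rightarrow> ('c \<times> 'b \<Rightarrow> 'm) \<Rightarrow> ('b \<times> 'a \<Rightarrow> 'm) \<Rightarrow> ('c \<times> 'a \<Rightarrow> 'm)"
  where "dist_comp Q A B C \<Psi> \<Phi> =
    (\<lambda>(c, a) \<in> objs C \<times> objs A.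
      \<Squnion>\<^bsub>Hom Q (ty A a) (ty C c)\<^esub>
        ((\<lambda>b. Comp Q (ty A a) (ty B b) (ty C c) (\<Psi> (c, b)) (\<Phi> (b, a))) ` objs B))"

text \<open>
  \<^term>\<open>dist_lift Q A B C \<Psi> \<Xi>\<close> is \<open>[\<Psi>,\<Xi>]\<close> in \<open>Dist(Q)\<close>, for \<open>\<Psi>\<close> from \<open>B\<close> to \<open>C\<close> and \<open>\<Xi>\<close> from
  \<open>A\<close> to \<open>C\<close>: the largest \<open>X\<close> from \<open>A\<close> to \<open>B\<close> with \<open>\<Psi> \<otimes>\<^sub>B X \<le> \<Xi>\<close>.
\<close>

definition dist_lift ::
  "('o, 'm) quantaloid \<Rightarrow> ('a, 'o, 'm) qcat \<Rightarrow> ('b, 'o, 'm) qcat \<Rightarrow> ('c, 'o, 'm) qcat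
    \<Rightarrow> ('c \<times> 'b \<Rightarrow> 'm) \<Rightarrow> ('c \<times> 'a \<Rightarrow> 'm) \<Rightarrow> ('b \<times> 'a \<Rightarrow> 'm)"
  where "dist_lift Q A B C \<Psi> \<Xi> =
    (THE X. greatest (Dist Q A B) X
       {X \<in> carrier (Dist Q A B). dist_comp Q A B C \<Psi> X \<sqsubseteq>\<^bsub>Dist Q A C\<^esub> \<Xi>})"

text \<open>For a functor \<open>F\<close> from \<open>A\<close> to \<open>B\<close>, this is the distributor \<open>B(F-,-)\<close> from \<open>B\<close> to \<open>A\<close>.\<close>

definition conjoint ::
  "('a, 'o, 'm) qcat \<Rightarrow> ('b, 'o, 'm) qcat \<Rightarrow> ('a \<Rightarrow> 'b) \<Rightarrow> ('a \<times> 'b \<Rightarrow> 'm)"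
  where "conjoint A B F = (\<lambda>(a, b) \<in> objs A \<times> objs B. hom B (F a) b)"


section \<open>The locally ordered 2-category of functors\<close>

text \<open>Functors are compared only on the objects of their domain.\<close>

definition functor_le ::
  "('o, 'm) quantaloid \<Rightarrow> ('a, 'o, 'm) qcat \<Rightarrow> ('b, 'o, 'm) qcat
    \<Rightarrow> ('a \<Rightarrow> 'b) \<Rightarrow> ('a \<Rightarrow> 'b) \<Rightarrow> bool"
  where "functor_le Q A B F G \<longleftrightarrow>
    (\<forall>a\<in>objs A. Id Q (ty A a) \<sqsubseteq>\<^bsub>Hom Q (ty A a) (ty A a)\<^esub> hom B (F a) (G a))"

definition functor_iso ::
  "('o, 'm) quantaloid \<Rightarrow> ('a, 'o, 'm) qcat \<Rightarrow> ('b, 'o, 'm) qcat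
    \<Rightarrow> ('a \<Rightarrow> 'b) \<Rightarrow> ('a \<Rightarrow> 'b) \<Rightarrow> bool"
  where "functor_iso Q A B F G \<longleftrightarrow> functor_le Q A B F G \<and> functor_le Q A B G F"

definition left_adjoint ::
  "('o, 'm) quantaloid \<Rightarrow> ('a, 'o, 'm) qcat \<Rightarrow> ('b, 'o, 'm) qcat
    \<Rightarrow> ('a \<Rightarrow> 'b) \<Rightarrow> ('b \<Rightarrow> 'a) \<Rightarrow> bool"
  where "left_adjoint Q A B F G \<longleftrightarrow>
    qfunctor Q A B F \<and> qfunctor Q B A G \<and>
    functor_le Q A A id (G \<circ> F) \<and> functor_le Q B B (F \<circ> G) id"


section \<open>Weighted colimits and Kan extensions\<close>

text \<open>\<open>K\<close> from \<open>C\<close> to \<open>B\<close> is the \<open>\<Theta>\<close>-weighted colimit of \<open>F\<close> from \<open>A\<close> to \<open>B\<close>, \<open>\<Theta>\<close> from \<open>C\<close> to \<open>A\<close>.\<close>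

definition is_colim ::
  "('o, 'm) quantaloid \<Rightarrow> ('c, 'o, 'm) qcat \<Rightarrow> ('a, 'o, 'm) qcat \<Rightarrow> ('b, 'o, 'm) qcat
    \<Rightarrow> ('a \<times> 'c \<Rightarrow> 'm) \<Rightarrow> ('a \<Rightarrow> 'b) \<Rightarrow> ('c \<Rightarrow> 'b) \<Rightarrow> bool"
  where "is_colim Q C A B \<Theta> F K \<longleftrightarrow>
    distributor Q C A \<Theta> \<and> qfunctor Q A B F \<and> qfunctor Q C B K \<and>
    conjoint C B K = dist_lift Q B C A \<Theta> (conjoint A B F)"

text \<open>
  Cocontinuity concerns weights between arbitrary \<open>Q\<close>-categories, but a formula cannot quantify
  over types. The first two arguments are the types from which the objects of the domain \<open>C\<close> and
  the codomain \<open>D\<close> of the weights are drawn: a functor is cocontinuous if it satisfies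
  \<^term>\<open>cocontinuous TYPE('c) TYPE('d) Q B B' F'\<close> for all types \<open>'c\<close> and \<open>'d\<close>. As a
  conclusion this is stated with type variables that occur nowhere else. As a hypothesis it can only
  be required at particular types, which asks for less than cocontinuity.
\<close>

definition cocontinuous ::
  "'c itself \<Rightarrow> 'd itself \<Rightarrow> ('o, 'm) quantaloid \<Rightarrow> ('b, 'o, 'm) qcat \<Rightarrow> ('e, 'o, 'm) qcat
    \<Rightarrow> ('b \<Rightarrow> 'e) \<Rightarrow> bool"
  where "cocontinuous tc td Q B B' F' \<longleftrightarrow>
    qfunctor Q B B' F' \<and>
    (\<forall>(C :: ('c, 'o, 'm) qcat) (D :: ('d, 'o, 'm) qcat) \<Theta> F K.
       is_colim Q C D B \<Theta> F K \<longrightarrow>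
       (\<exists>L. is_colim Q C D B' \<Theta> (F' \<circ> F) L \<and> functor_iso Q C B' L (F' \<circ> K)))"

text \<open>\<open>K\<close> from \<open>C\<close> to \<open>B\<close> is the left Kan extension of \<open>F\<close> from \<open>A\<close> to \<open>B\<close> along \<open>G\<close> from \<open>A\<close> to \<open>C\<close>.\<close>

definition is_lan ::
  "('o, 'm) quantaloid \<Rightarrow> ('a, 'o, 'm) qcat \<Rightarrow> ('b, 'o, 'm) qcat \<Rightarrow> ('c, 'o, 'm) qcat
    \<Rightarrow> ('a \<Rightarrow> 'b) \<Rightarrow> ('a \<Rightarrow> 'c) \<Rightarrow> ('c \<Rightarrow> 'b) \<Rightarrow> bool"
  where "is_lan Q A B C F G K \<longleftrightarrow>
    qfunctor Q A B F \<and> qfunctor Q A C G \<and> qfunctor Q C B K \<and>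
    functor_le Q A B F (K \<circ> G) \<and>
    (\<forall>K'. qfunctor Q C B K' \<longrightarrow> functor_le Q A B F (K' \<circ> G) \<longrightarrow> functor_le Q C B K K')"

definition is_pointwise_lan ::
  "('o, 'm) quantaloid \<Rightarrow> ('a, 'o, 'm) qcat \<Rightarrow> ('b, 'o, 'm) qcat \<Rightarrow> ('c, 'o, 'm) qcat
    \<Rightarrow> ('a \<Rightarrow> 'b) \<Rightarrow> ('a \<Rightarrow> 'c) \<Rightarrow> ('c \<Rightarrow> 'b) \<Rightarrow> bool"
  where "is_pointwise_lan Q A B C F G K \<longleftrightarrow>
    is_lan Q A B C F G K \<and> (\<exists>L. is_colim Q C A B (conjoint A C G) F L)"


section \<open>Presheaves and the Yoneda embedding\<close>

definition star :: "('o, 'm) quantaloid \<Rightarrow> 'o \<Rightarrow> (unit, 'o, 'm) qcat"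
  where "star Q C = \<lparr>objs = {()}, ty = (\<lambda>_. C), hom = (\<lambda>_ _. Id Q C)\<rparr>"

text \<open>
  An object of the presheaf category is a pair of its type \<open>C\<close> and a distributor from
  \<^term>\<open>star Q C\<close> to \<open>A\<close>; the distributor as a function need not determine \<open>C\<close>.
\<close>

definition PSh ::
  "('o, 'm) quantaloid \<Rightarrow> ('a, 'o, 'm) qcat \<Rightarrow> ('o \<times> ('a \<times> unit \<Rightarrow> 'm), 'o, 'm) qcat"
  where "PSh Q A =
    \<lparr>objs = {(C, \<phi>). C \<in> Obj Q \<and> distributor Q (star Q C) A \<phi>},
     ty = fst,
     hom = (\<lambda>(C', \<psi>) (C, \<phi>). dist_lift Q (star Q C) (star Q C') A \<psi> \<phi> ((), ()))\<rparr>"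

definition yoneda :: "('a, 'o, 'm) qcat \<Rightarrow> 'a \<Rightarrow> 'o \<times> ('a \<times> unit \<Rightarrow> 'm)"
  where "yoneda A a = (ty A a, \<lambda>(a', u) \<in> objs A \<times> {()}. hom A a' a)"

end

theory Submission
  imports Defs
begin

text \<open>
  The whole argument is elementwise: an arrow of a quantaloid is determined by the arrows below it,
  and \<open>x \<le> [\<Psi>,\<Xi>](b,a)\<close> means \<open>\<Psi>(c,b) \<circ> x \<le> \<Xi>(c,a)\<close> for all \<open>c\<close> (\<open>le_dist_lift_iff\<close>). Hence a
  weighted colimit is nothing but a choice, for each column \<open>\<phi>\<close> of the weight, of an object \<open>k\<close> for
  which \<open>x \<le> B(k,b)\<close> is equivalent to \<open>\<phi>(a) \<circ> x \<le> B(Fa,b)\<close> for all \<open>a\<close> (\<open>is_colim_iff\<close>).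

  By the Yoneda lemma the column at a presheaf \<open>\<phi>\<close> of the weight \<open>PA(Y-,-)\<close> is \<open>\<phi>\<close> itself. A pointwise
  Kan extension \<open>K\<close> of \<open>F\<close> along \<open>Y\<close> is therefore the same thing as a choice of \<open>\<phi>\<close>-weighted colimits
  \<open>K \<phi>\<close> of \<open>F\<close>, which is the claimed equivalence (\<open>pointwise_lan_yoneda_iff\<close>). The condition on
  \<open>K \<phi>\<close> also reads \<open>B(K \<phi>, b) = PA(\<phi>, B(F-,b))\<close>, so that \<open>K\<close> is left adjoint to the nerve
  \<open>b \<mapsto> B(F-,b)\<close>, and a left adjoint is cocontinuous.

  Applied to \<open>Y\<close> in place of \<open>F\<close>, the Yoneda lemma shows that each presheaf is the colimit of
  representables weighted by itself (\<open>yoneda_density\<close>). This has two uses. For the presheaves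
  \<open>B(F-,b)\<close> it exhibits the nerve as the Kan extension of \<open>Y\<close> along \<open>F\<close> (\<open>nerve_is_lan\<close>). And a
  cocontinuous \<open>G\<close> with \<open>G \<circ> Y \<cong> F\<close> has to send \<open>\<phi>\<close> to the \<open>\<phi>\<close>-weighted colimit of \<open>F\<close>, which is
  \<open>K \<phi>\<close>.
\<close>

section \<open>Order and composition in a quantaloid\<close>

context quantaloid
begin

lemma le_refl:
  assumes "X \<in> Obj Q" "Y \<in> Obj Q" "f \<in> carrier (Hom Q X Y)"
  shows "f \<sqsubseteq>\<^bsub>Hom Q X Y\<^esub> f"
proof -
  interpret sup_lattice "Hom Q X Y" using assms by (intro hom_sup_lattice)
  show ?thesis using assms by simp
qed

lemma le_trans:
  assumes "X \<in> Obj Q" "Y \<in> Obj Q"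
    and "f \<in> carrier (Hom Q X Y)" "g \<in> carrier (Hom Q X Y)" "h \<in> carrier (Hom Q X Y)"
    and "f \<sqsubseteq>\<^bsub>Hom Q X Y\<^esub> g" "g \<sqsubseteq>\<^bsub>Hom Q X Y\<^esub> h"
  shows "f \<sqsubseteq>\<^bsub>Hom Q X Y\<^esub> h"
proof -
  interpret sup_lattice "Hom Q X Y" using assms by (intro hom_sup_lattice)
  show ?thesis using assms le_trans by blast
qed

lemma le_antisym:
  assumes "X \<in> Obj Q" "Y \<in> Obj Q"
    and "f \<in> carrier (Hom Q X Y)" "g \<in> carrier (Hom Q X Y)"
    and "f \<sqsubseteq>\<^bsub>Hom Q X Y\<^esub> g" "g \<sqsubseteq>\<^bsub>Hom Q X Y\<^esub> f"
  shows "f = g"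
proof -
  interpret sup_lattice "Hom Q X Y" using assms by (intro hom_sup_lattice)
  show ?thesis using assms le_antisym by blast
qed

lemma eqI_lower:
  assumes "X \<in> Obj Q" "Y \<in> Obj Q"
    and "f \<in> carrier (Hom Q X Y)" "g \<in> carrier (Hom Q X Y)"
    and "\<And>x. x \<in> carrier (Hom Q X Y) \<Longrightarrow> x \<sqsubseteq>\<^bsub>Hom Q X Y\<^esub> f \<longleftrightarrow> x \<sqsubseteq>\<^bsub>Hom Q X Y\<^esub> g"
  shows "f = g"
proof (rule le_antisym[OF assms(1-4)])
  show "f \<sqsubseteq>\<^bsub>Hom Q X Y\<^esub> g" using assms(5)[OF assms(3)] le_refl[OF assms(1-3)] by simp
  show "g \<sqsubseteq>\<^bsub>Hom Q X Y\<^esub> f" using assms(5)[OF assms(4)] le_refl[OF assms(1,2,4)] by simp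
qed

lemma Sup_least:
  assumes "X \<in> Obj Q" "Y \<in> Obj Q" "S \<subseteq> carrier (Hom Q X Y)"
  shows "least (Hom Q X Y) (\<Squnion>\<^bsub>Hom Q X Y\<^esub> S) (Upper (Hom Q X Y) S)"
proof -
  interpret sup_lattice "Hom Q X Y" using assms by (intro hom_sup_lattice)
  show ?thesis unfolding sup_def using sup_exists[OF assms(3)] by (rule someI_ex)
qed

lemma Sup_closed:
  assumes "X \<in> Obj Q" "Y \<in> Obj Q" "S \<subseteq> carrier (Hom Q X Y)"
  shows "\<Squnion>\<^bsub>Hom Q X Y\<^esub> S \<in> carrier (Hom Q X Y)"
  using Sup_least[OF assms] by (auto simp: least_def Upper_def)

lemma Sup_upper:
  assumes "X \<in> Obj Q" "Y \<in> Obj Q" "S \<subseteq> carrier (Hom Q X Y)" "s \<in> S"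
  shows "s \<sqsubseteq>\<^bsub>Hom Q X Y\<^esub> \<Squnion>\<^bsub>Hom Q X Y\<^esub> S"
  using Sup_least[OF assms(1-3)] assms by (auto simp: least_def Upper_def)

lemma Sup_le_iff:
  assumes "X \<in> Obj Q" "Y \<in> Obj Q" "S \<subseteq> carrier (Hom Q X Y)" "z \<in> carrier (Hom Q X Y)"
  shows "\<Squnion>\<^bsub>Hom Q X Y\<^esub> S \<sqsubseteq>\<^bsub>Hom Q X Y\<^esub> z \<longleftrightarrow> (\<forall>s\<in>S. s \<sqsubseteq>\<^bsub>Hom Q X Y\<^esub> z)"
proof
  assume "\<Squnion>\<^bsub>Hom Q X Y\<^esub> S \<sqsubseteq>\<^bsub>Hom Q X Y\<^esub> z"
  then show "\<forall>s\<in>S. s \<sqsubseteq>\<^bsub>Hom Q X Y\<^esub> z"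
    using assms Sup_upper Sup_closed le_trans by (meson subsetD)
next
  assume "\<forall>s\<in>S. s \<sqsubseteq>\<^bsub>Hom Q X Y\<^esub> z"
  then have "z \<in> Upper (Hom Q X Y) S" using assms by (auto simp: Upper_def)
  then show "\<Squnion>\<^bsub>Hom Q X Y\<^esub> S \<sqsubseteq>\<^bsub>Hom Q X Y\<^esub> z"
    using Sup_least[OF assms(1-3)] by (auto simp: least_def)
qed

lemma Sup_pair:
  assumes "X \<in> Obj Q" "Y \<in> Obj Q"
    and "f \<in> carrier (Hom Q X Y)" "g \<in> carrier (Hom Q X Y)" "f \<sqsubseteq>\<^bsub>Hom Q X Y\<^esub> g"
  shows "\<Squnion>\<^bsub>Hom Q X Y\<^esub> {f, g} = g"
  using assms by (intro le_antisym[of X Y]) (auto simp: Sup_le_iff le_refl intro: Sup_closed Sup_upper)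

text \<open>Preservation of the two-element suprema \<open>f \<squnion> f' = f'\<close> already forces monotonicity.\<close>

lemma Comp_mono:
  assumes "X \<in> Obj Q" "Y \<in> Obj Q" "Z \<in> Obj Q"
    and "f \<in> carrier (Hom Q X Y)" "f' \<in> carrier (Hom Q X Y)" "f \<sqsubseteq>\<^bsub>Hom Q X Y\<^esub> f'"
    and "g \<in> carrier (Hom Q Y Z)" "g' \<in> carrier (Hom Q Y Z)" "g \<sqsubseteq>\<^bsub>Hom Q Y Z\<^esub> g'"
  shows "Comp Q X Y Z g f \<sqsubseteq>\<^bsub>Hom Q X Z\<^esub> Comp Q X Y Z g' f'"
proof -
  have "Comp Q X Y Z g f \<sqsubseteq>\<^bsub>Hom Q X Z\<^esub> \<Squnion>\<^bsub>Hom Q X Z\<^esub> ((\<lambda>f. Comp Q X Y Z g f) ` {f, f'})"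
    using assms by (intro Sup_upper) (auto intro: Comp_closed)
  also have "\<dots> = Comp Q X Y Z g f'"
    using assms by (subst Comp_Sup_right[symmetric]) (auto simp: Sup_pair)
  finally have 1: "Comp Q X Y Z g f \<sqsubseteq>\<^bsub>Hom Q X Z\<^esub> Comp Q X Y Z g f'" .
  have "Comp Q X Y Z g f' \<sqsubseteq>\<^bsub>Hom Q X Z\<^esub> \<Squnion>\<^bsub>Hom Q X Z\<^esub> ((\<lambda>g. Comp Q X Y Z g f') ` {g, g'})"
    using assms by (intro Sup_upper) (auto intro: Comp_closed)
  also have "\<dots> = Comp Q X Y Z g' f'"
    using assms by (subst Comp_Sup_left[symmetric]) (auto simp: Sup_pair)
  finally have 2: "Comp Q X Y Z g f' \<sqsubseteq>\<^bsub>Hom Q X Z\<^esub> Comp Q X Y Z g' f'" .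
  show ?thesis by (rule le_trans[OF _ _ _ _ _ 1 2]) (use assms in \<open>auto intro: Comp_closed\<close>)
qed

text \<open>
  Each condition \<open>g i \<circ> x \<le> h i\<close> is stable under suprema in \<open>x\<close>, because composition with \<open>g i\<close>
  preserves them; so the supremum of all solutions is a solution.
\<close>

lemma residual_exists:
  assumes X: "X \<in> Obj Q" and Y: "Y \<in> Obj Q"
    and Z: "\<And>i. i \<in> I \<Longrightarrow> Z i \<in> Obj Q"
    and g: "\<And>i. i \<in> I \<Longrightarrow> g i \<in> carrier (Hom Q Y (Z i))"
    and h: "\<And>i. i \<in> I \<Longrightarrow> h i \<in> carrier (Hom Q X (Z i))"
  shows "\<exists>r\<in>carrier (Hom Q X Y). \<forall>x\<in>carrier (Hom Q X Y).
           x \<sqsubseteq>\<^bsub>Hom Q X Y\<^esub> r \<longleftrightarrow> (\<forall>i\<in>I. Comp Q X Y (Z i) (g i) x \<sqsubseteq>\<^bsub>Hom Q X (Z i)\<^esub> h i)"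
proof (intro bexI ballI iffI)
  let ?S = "{x \<in> carrier (Hom Q X Y). \<forall>i\<in>I. Comp Q X Y (Z i) (g i) x \<sqsubseteq>\<^bsub>Hom Q X (Z i)\<^esub> h i}"
  have S: "?S \<subseteq> carrier (Hom Q X Y)" by blast
  show r: "\<Squnion>\<^bsub>Hom Q X Y\<^esub> ?S \<in> carrier (Hom Q X Y)"
    using X Y S by (rule Sup_closed)
  fix x assume x: "x \<in> carrier (Hom Q X Y)"
  show "x \<sqsubseteq>\<^bsub>Hom Q X Y\<^esub> \<Squnion>\<^bsub>Hom Q X Y\<^esub> ?S"
    if "\<forall>i\<in>I. Comp Q X Y (Z i) (g i) x \<sqsubseteq>\<^bsub>Hom Q X (Z i)\<^esub> h i"
    using X Y S x that by (intro Sup_upper) auto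
  fix i assume le: "x \<sqsubseteq>\<^bsub>Hom Q X Y\<^esub> \<Squnion>\<^bsub>Hom Q X Y\<^esub> ?S" and i: "i \<in> I"
  have "Comp Q X Y (Z i) (g i) (\<Squnion>\<^bsub>Hom Q X Y\<^esub> ?S)
      = \<Squnion>\<^bsub>Hom Q X (Z i)\<^esub> ((\<lambda>f. Comp Q X Y (Z i) (g i) f) ` ?S)"
    using X Y Z[OF i] S g[OF i] by (rule Comp_Sup_right)
  also have "\<dots> \<sqsubseteq>\<^bsub>Hom Q X (Z i)\<^esub> h i"
    using X Y Z[OF i] g[OF i] h[OF i] i by (subst Sup_le_iff) (auto intro: Comp_closed)
  finally have 1: "Comp Q X Y (Z i) (g i) (\<Squnion>\<^bsub>Hom Q X Y\<^esub> ?S) \<sqsubseteq>\<^bsub>Hom Q X (Z i)\<^esub> h i" .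
  have 2: "Comp Q X Y (Z i) (g i) x \<sqsubseteq>\<^bsub>Hom Q X (Z i)\<^esub> Comp Q X Y (Z i) (g i) (\<Squnion>\<^bsub>Hom Q X Y\<^esub> ?S)"
    using X Y Z[OF i] g[OF i] x r le le_refl by (intro Comp_mono) auto
  show "Comp Q X Y (Z i) (g i) x \<sqsubseteq>\<^bsub>Hom Q X (Z i)\<^esub> h i"
    by (rule le_trans[OF _ _ _ _ _ 2 1]) (use X Y Z[OF i] g[OF i] h[OF i] x r in \<open>auto intro: Comp_closed\<close>)
qed

end

section \<open>Hom-arrows and functors\<close>

context qcategory
begin

lemma comp_le_hom:
  assumes "a \<in> objs A" "a' \<in> objs A" "a'' \<in> objs A"
    and "f \<in> carrier (Hom Q (ty A a) (ty A a'))"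
    and "f \<sqsubseteq>\<^bsub>Hom Q (ty A a) (ty A a')\<^esub> hom A a' a"
    and "g \<in> carrier (Hom Q (ty A a') (ty A a''))"
    and "g \<sqsubseteq>\<^bsub>Hom Q (ty A a') (ty A a'')\<^esub> hom A a'' a'"
  shows "Comp Q (ty A a) (ty A a') (ty A a'') g f \<sqsubseteq>\<^bsub>Hom Q (ty A a) (ty A a'')\<^esub> hom A a'' a"
  by (rule le_trans[OF _ _ _ _ _ Comp_mono hom_comp[of a a' a'']])
     (use assms in \<open>auto intro: Comp_closed hom_closed ty_closed\<close>)

lemma hom_mono_right:
  assumes "a \<in> objs A" "a' \<in> objs A" "z \<in> objs A" "ty A a' = ty A a"
    and "Id Q (ty A a) \<sqsubseteq>\<^bsub>Hom Q (ty A a) (ty A a)\<^esub> hom A a a'"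
  shows "hom A z a \<sqsubseteq>\<^bsub>Hom Q (ty A a) (ty A z)\<^esub> hom A z a'"
proof -
  have "Comp Q (ty A a') (ty A a) (ty A z) (hom A z a) (Id Q (ty A a))
      \<sqsubseteq>\<^bsub>Hom Q (ty A a') (ty A z)\<^esub> hom A z a'"
    using assms Id_closed[OF ty_closed, of a]
    by (intro comp_le_hom) (auto intro: hom_closed le_refl ty_closed)
  then show ?thesis using assms by (simp add: Comp_Id_right ty_closed hom_closed)
qed

lemma hom_mono_left:
  assumes "a \<in> objs A" "a' \<in> objs A" "z \<in> objs A" "ty A a' = ty A a"
    and "Id Q (ty A a) \<sqsubseteq>\<^bsub>Hom Q (ty A a) (ty A a)\<^esub> hom A a a'"
  shows "hom A a' z \<sqsubseteq>\<^bsub>Hom Q (ty A z) (ty A a)\<^esub> hom A a z"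
proof -
  have "Comp Q (ty A z) (ty A a') (ty A a) (Id Q (ty A a)) (hom A a' z)
      \<sqsubseteq>\<^bsub>Hom Q (ty A z) (ty A a)\<^esub> hom A a z"
    using assms Id_closed[OF ty_closed, of a] hom_closed[of z a'] 
    by (intro comp_le_hom) (auto intro: hom_closed le_refl ty_closed)
  moreover have "hom A a' z \<in> carrier (Hom Q (ty A z) (ty A a))"
    using assms hom_closed[of z a'] by auto
  ultimately show ?thesis using assms by (simp add: Comp_Id_left ty_closed)
qed

end

context qfunctor
begin

lemma maps: "a \<in> objs A \<Longrightarrow> F a \<in> objs B"
  using maps_objs by blast

lemma hom_closed':
  assumes "a \<in> objs A" "b \<in> objs B"
  shows "hom B (F a) b \<in> carrier (Hom Q (ty B b) (ty A a))"
    and "hom B b (F a) \<in> carrier (Hom Q (ty A a) (ty B b))"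
  using cod.hom_closed[of b "F a"] cod.hom_closed[of "F a" b] maps[of a] assms ty_preserving[of a]
  by auto

end

section \<open>Liftings of distributors\<close>

lemma distributor_closed:
  assumes "distributor Q A B \<Phi>" "a \<in> objs A" "b \<in> objs B"
  shows "\<Phi> (b, a) \<in> carrier (Hom Q (ty A a) (ty B b))"
proof -
  have "\<Phi> (b, a) \<in> (case (b, a) of (b, a) \<Rightarrow> carrier (Hom Q (ty A a) (ty B b)))"
    by (rule PiE_mem[OF distributor.family[OF assms(1)]]) (use assms in auto)
  then show ?thesis by simp
qed

text \<open>
  Universal properties describe the arrows below a given one, so this is the form in which
  distributors are compared.
\<close>

lemma distributor_eqI:
  assumes "distributor Q A B \<Phi>" "distributor Q A B \<Psi>"
    and "\<And>a b x. \<lbrakk>a \<in> objs A; b \<in> objs B; x \<in> carrier (Hom Q (ty A a) (ty B b))\<rbrakk>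
           \<Longrightarrow> x \<sqsubseteq>\<^bsub>Hom Q (ty A a) (ty B b)\<^esub> \<Phi> (b, a)
             \<longleftrightarrow> x \<sqsubseteq>\<^bsub>Hom Q (ty A a) (ty B b)\<^esub> \<Psi> (b, a)"
  shows "\<Phi> = \<Psi>"
proof (rule PiE_ext[OF distributor.family[OF assms(1)] distributor.family[OF assms(2)]])
  interpret distributor Q A B \<Phi> by fact
  fix p assume "p \<in> objs B \<times> objs A"
  then obtain a b where p: "p = (b, a)" "a \<in> objs A" "b \<in> objs B" by auto
  show "\<Phi> p = \<Psi> p"
    unfolding p(1) using p(2,3) assms
    by (intro dom.eqI_lower[of "ty A a" "ty B b"])
       (auto intro: distributor_closed dom.ty_closed cod.ty_closed)
qed

text \<open>
  A lifting is computed elementwise: \<open>[\<Psi>,\<Xi>](b,a)\<close> is the largest arrow \<open>x\<close> with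
  \<open>\<Psi>(c,b) \<circ> x \<le> \<Xi>(c,a)\<close> for all \<open>c\<close>. These arrows form a distributor, and being defined by
  a universal property they are seen to be the greatest one at once. Everything below uses liftings
  only through this description.
\<close>

lemma dist_lift_universal:
  assumes A: "qcategory Q A" and \<Psi>: "distributor Q B C \<Psi>" and \<Xi>: "distributor Q A C \<Xi>"
  shows dist_lift_distributor: "distributor Q A B (dist_lift Q A B C \<Psi> \<Xi>)" (is ?dist)
    and le_dist_lift_iff: "\<lbrakk>a \<in> objs A; b \<in> objs B; x \<in> carrier (Hom Q (ty A a) (ty B b))\<rbrakk>
      \<Longrightarrow> x \<sqsubseteq>\<^bsub>Hom Q (ty A a) (ty B b)\<^esub> dist_lift Q A B C \<Psi> \<Xi> (b, a) \<longleftrightarrow>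
        (\<forall>c\<in>objs C. Comp Q (ty A a) (ty B b) (ty C c) (\<Psi> (c, b)) x
          \<sqsubseteq>\<^bsub>Hom Q (ty A a) (ty C c)\<^esub> \<Xi> (c, a))" (is "\<lbrakk>_; _; _\<rbrakk> \<Longrightarrow> ?iff a b x")
proof -
  interpret A: qcategory Q A by fact
  interpret \<Psi>: distributor Q B C \<Psi> by fact
  interpret \<Xi>: distributor Q A C \<Xi> by fact
  note closed = A.hom_closed \<Psi>.dom.hom_closed distributor_closed[OF \<Psi>] distributor_closed[OF \<Xi>]
    A.ty_closed \<Psi>.dom.ty_closed \<Psi>.cod.ty_closed A.Comp_closed
  have "\<forall>b\<in>objs B. \<forall>a\<in>objs A. \<exists>r\<in>carrier (Hom Q (ty A a) (ty B b)).
      \<forall>x\<in>carrier (Hom Q (ty A a) (ty B b)). x \<sqsubseteq>\<^bsub>Hom Q (ty A a) (ty B b)\<^esub> r \<longleftrightarrow>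
        (\<forall>c\<in>objs C. Comp Q (ty A a) (ty B b) (ty C c) (\<Psi> (c, b)) x
          \<sqsubseteq>\<^bsub>Hom Q (ty A a) (ty C c)\<^esub> \<Xi> (c, a))"
    by (intro ballI A.residual_exists) (auto intro: closed)
  then obtain r where r: "\<And>a b. \<lbrakk>a \<in> objs A; b \<in> objs B\<rbrakk> \<Longrightarrow> r b a \<in> carrier (Hom Q (ty A a) (ty B b))"
    and r_iff: "\<And>a b x. \<lbrakk>a \<in> objs A; b \<in> objs B; x \<in> carrier (Hom Q (ty A a) (ty B b))\<rbrakk> \<Longrightarrow>
      x \<sqsubseteq>\<^bsub>Hom Q (ty A a) (ty B b)\<^esub> r b a \<longleftrightarrow>
        (\<forall>c\<in>objs C. Comp Q (ty A a) (ty B b) (ty C c) (\<Psi> (c, b)) x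
          \<sqsubseteq>\<^bsub>Hom Q (ty A a) (ty C c)\<^esub> \<Xi> (c, a))"
    by metis
  have ev: "Comp Q (ty A a) (ty B b) (ty C c) (\<Psi> (c, b)) (r b a) \<sqsubseteq>\<^bsub>Hom Q (ty A a) (ty C c)\<^esub> \<Xi> (c, a)"
    if "a \<in> objs A" "b \<in> objs B" "c \<in> objs C" for a b c
    using r_iff[OF that(1,2) r[OF that(1,2)]] that r[OF that(1,2)] A.le_refl[of "ty A a" "ty B b"]
    by (auto intro: closed)
  define R where "R = (\<lambda>(b, a) \<in> objs B \<times> objs A. r b a)"
  have R: "distributor Q A B R"
  proof (unfold_locales, goal_cases)
    case 1
    show ?case unfolding R_def by (rule restrict_PiE_iff[THEN iffD2]) (auto intro: r)
  next
    case (2 a b b')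
    have "Comp Q (ty A a) (ty B b) (ty B b') (hom B b' b) (r b a) \<sqsubseteq>\<^bsub>Hom Q (ty A a) (ty B b')\<^esub> r b' a"
    proof (subst r_iff, goal_cases)
      case 4
      show ?case
      proof
        fix c assume c: "c \<in> objs C"
        have eq: "Comp Q (ty A a) (ty B b') (ty C c) (\<Psi> (c, b'))
              (Comp Q (ty A a) (ty B b) (ty B b') (hom B b' b) (r b a))
           = Comp Q (ty A a) (ty B b) (ty C c)
              (Comp Q (ty B b) (ty B b') (ty C c) (\<Psi> (c, b')) (hom B b' b)) (r b a)"
          using 2 c by (intro A.Comp_assoc) (auto intro: closed r)
        have le: "\<dots> \<sqsubseteq>\<^bsub>Hom Q (ty A a) (ty C c)\<^esub> Comp Q (ty A a) (ty B b) (ty C c) (\<Psi> (c, b)) (r b a)"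
          using 2 c by (intro A.Comp_mono \<Psi>.right_action A.le_refl) (auto intro: closed r)
        show "Comp Q (ty A a) (ty B b') (ty C c) (\<Psi> (c, b'))
              (Comp Q (ty A a) (ty B b) (ty B b') (hom B b' b) (r b a))
              \<sqsubseteq>\<^bsub>Hom Q (ty A a) (ty C c)\<^esub> \<Xi> (c, a)"
          unfolding eq
          by (rule A.le_trans[OF _ _ _ _ _ le ev]) (use 2 c in \<open>auto intro!: closed r\<close>)
      qed
    qed (use 2 in \<open>auto intro: closed r\<close>)
    then show ?case using 2 by (simp add: R_def)
  next
    case (3 a a' b)
    have "Comp Q (ty A a') (ty A a) (ty B b) (r b a) (hom A a a') \<sqsubseteq>\<^bsub>Hom Q (ty A a') (ty B b)\<^esub> r b a'"
    proof (subst r_iff, goal_cases)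
      case 4
      show ?case
      proof
        fix c assume c: "c \<in> objs C"
        have eq: "Comp Q (ty A a') (ty B b) (ty C c) (\<Psi> (c, b))
              (Comp Q (ty A a') (ty A a) (ty B b) (r b a) (hom A a a'))
           = Comp Q (ty A a') (ty A a) (ty C c)
              (Comp Q (ty A a) (ty B b) (ty C c) (\<Psi> (c, b)) (r b a)) (hom A a a')"
          using 3 c by (intro A.Comp_assoc) (auto intro: closed r)
        have le: "\<dots> \<sqsubseteq>\<^bsub>Hom Q (ty A a') (ty C c)\<^esub> Comp Q (ty A a') (ty A a) (ty C c) (\<Xi> (c, a)) (hom A a a')"
          using 3 c by (intro A.Comp_mono ev A.le_refl) (auto intro: closed r)
        show "Comp Q (ty A a') (ty B b) (ty C c) (\<Psi> (c, b))
              (Comp Q (ty A a') (ty A a) (ty B b) (r b a) (hom A a a'))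
              \<sqsubseteq>\<^bsub>Hom Q (ty A a') (ty C c)\<^esub> \<Xi> (c, a')"
          unfolding eq
          by (rule A.le_trans[OF _ _ _ _ _ le \<Xi>.right_action]) (use 3 c in \<open>auto intro!: closed r\<close>)
      qed
    qed (use 3 in \<open>auto intro: closed r\<close>)
    then show ?case using 3 by (simp add: R_def)
  qed
  have comp_le_iff: "dist_comp Q A B C \<Psi> X \<sqsubseteq>\<^bsub>Dist Q A C\<^esub> \<Xi> \<longleftrightarrow> X \<sqsubseteq>\<^bsub>Dist Q A B\<^esub> R"
    if X: "distributor Q A B X" for X
  proof -
    have "dist_comp Q A B C \<Psi> X \<sqsubseteq>\<^bsub>Dist Q A C\<^esub> \<Xi> \<longleftrightarrow>
      (\<forall>a\<in>objs A. \<forall>c\<in>objs C. \<forall>b\<in>objs B.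
        Comp Q (ty A a) (ty B b) (ty C c) (\<Psi> (c, b)) (X (b, a)) \<sqsubseteq>\<^bsub>Hom Q (ty A a) (ty C c)\<^esub> \<Xi> (c, a))"
      unfolding Dist_def dist_comp_def
      using distributor_closed[OF X] by (auto simp: A.Sup_le_iff closed image_subset_iff)
    also have "\<dots> \<longleftrightarrow> X \<sqsubseteq>\<^bsub>Dist Q A B\<^esub> R"
      unfolding Dist_def R_def using distributor_closed[OF X] by (auto simp: r_iff)
    finally show ?thesis .
  qed
  have "dist_lift Q A B C \<Psi> \<Xi> = R"
    unfolding dist_lift_def
  proof (rule the_equality)
    have refl: "R \<sqsubseteq>\<^bsub>Dist Q A B\<^esub> R"
      using distributor_closed[OF R] by (auto simp: Dist_def A.le_refl closed)
    show "greatest (Dist Q A B) R {X \<in> carrier (Dist Q A B). dist_comp Q A B C \<Psi> X \<sqsubseteq>\<^bsub>Dist Q A C\<^esub> \<Xi>}"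
      unfolding greatest_def using R refl comp_le_iff by (auto simp: Dist_def)
    fix X assume "greatest (Dist Q A B) X {X \<in> carrier (Dist Q A B). dist_comp Q A B C \<Psi> X \<sqsubseteq>\<^bsub>Dist Q A C\<^esub> \<Xi>}"
    then have X: "distributor Q A B X" "X \<sqsubseteq>\<^bsub>Dist Q A B\<^esub> R" "R \<sqsubseteq>\<^bsub>Dist Q A B\<^esub> X"
      unfolding greatest_def using R refl comp_le_iff by (auto simp: Dist_def)
    show "X = R"
    proof (rule PiE_ext[OF distributor.family[OF X(1)] distributor.family[OF R]])
      fix p assume "p \<in> objs B \<times> objs A"
      then obtain a b where p: "p = (b, a)" "a \<in> objs A" "b \<in> objs B" by auto
      show "X p = R p"
        unfolding p(1) using p(2,3) X
        by (intro A.le_antisym[of "ty A a" "ty B b"])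
           (auto intro: distributor_closed R closed simp: Dist_def)
    qed
  qed
  then show ?dist and "\<lbrakk>a \<in> objs A; b \<in> objs B; x \<in> carrier (Hom Q (ty A a) (ty B b))\<rbrakk> \<Longrightarrow> ?iff a b x"
    using R r_iff by (auto simp: R_def)
qed

section \<open>Weighted colimits, elementwise\<close>

lemma conjoint_distributor:
  assumes "qfunctor Q A B F"
  shows "distributor Q B A (conjoint A B F)"
proof -
  interpret qfunctor Q A B F by fact
  show ?thesis
  proof (unfold_locales, goal_cases)
    case 1
    show ?case unfolding conjoint_def
      by (rule restrict_PiE_iff[THEN iffD2]) (auto intro: hom_closed')
  next
    case (2 b a a')
    then show ?case
      using cod.comp_le_hom[of b "F a" "F a'" "hom B (F a) b" "hom A a' a"]
        dom.hom_closed[of a a'] hom_le[of a a'] hom_closed'[of a b]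
      by (simp add: conjoint_def ty_preserving maps dom.le_refl dom.ty_closed cod.ty_closed)
  next
    case (3 b b' a)
    then show ?case
      using cod.hom_comp[of b' b "F a"] by (simp add: conjoint_def ty_preserving maps)
  qed
qed

text \<open>
  The object \<open>k\<close> of type \<open>C\<close> represents the cocones under \<open>F\<close> with weight \<open>\<phi>\<close>. The weight enters
  only through its components \<open>\<phi> a : C \<rightarrow> ta\<close>, so that a column of an arbitrary distributor can
  take the place of a presheaf.
\<close>

definition colim_obj ::
  "('o, 'm) quantaloid \<Rightarrow> ('a, 'o, 'm) qcat \<Rightarrow> ('b, 'o, 'm) qcat
    \<Rightarrow> 'o \<Rightarrow> ('a \<Rightarrow> 'm) \<Rightarrow> ('a \<Rightarrow> 'b) \<Rightarrow> 'b \<Rightarrow> bool"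
  where "colim_obj Q A B C \<phi> F k \<longleftrightarrow>
    k \<in> objs B \<and> ty B k = C \<and>
    (\<forall>b\<in>objs B. \<forall>x\<in>carrier (Hom Q (ty B b) C).
       x \<sqsubseteq>\<^bsub>Hom Q (ty B b) C\<^esub> hom B k b \<longleftrightarrow>
         (\<forall>a\<in>objs A. Comp Q (ty B b) C (ty A a) (\<phi> a) x \<sqsubseteq>\<^bsub>Hom Q (ty B b) (ty A a)\<^esub> hom B (F a) b))"

lemma colim_obj_iff:
  assumes "colim_obj Q A B C \<phi> F k" "b \<in> objs B" "x \<in> carrier (Hom Q (ty B b) C)"
  shows "x \<sqsubseteq>\<^bsub>Hom Q (ty B b) C\<^esub> hom B k b \<longleftrightarrow>
    (\<forall>a\<in>objs A. Comp Q (ty B b) C (ty A a) (\<phi> a) x \<sqsubseteq>\<^bsub>Hom Q (ty B b) (ty A a)\<^esub> hom B (F a) b)"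
  using assms by (simp add: colim_obj_def)

text \<open>
  The case \<open>x = 1\<close> of the universal property: inequalities out of \<open>k\<close> are cocones.
\<close>

lemma colim_obj_le_iff:
  assumes k: "colim_obj Q A B C \<phi> F k" and B: "qcategory Q B" and A: "qcategory Q A"
    and b: "b \<in> objs B" "ty B b = C"
    and \<phi>: "\<And>a. a \<in> objs A \<Longrightarrow> \<phi> a \<in> carrier (Hom Q C (ty A a))"
  shows "Id Q C \<sqsubseteq>\<^bsub>Hom Q C C\<^esub> hom B k b \<longleftrightarrow>
    (\<forall>a\<in>objs A. \<phi> a \<sqsubseteq>\<^bsub>Hom Q C (ty A a)\<^esub> hom B (F a) b)"
proof -
  interpret A: qcategory Q A by fact
  interpret B: qcategory Q B by fact
  have "C \<in> Obj Q" using B.ty_closed b by blast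
  then show ?thesis
    using colim_obj_iff[OF k b(1), of "Id Q C"] b(2) \<phi>
    by (simp add: A.Id_closed A.Comp_Id_right A.ty_closed)
qed

lemma colim_obj_unit:
  assumes "colim_obj Q A B C \<phi> F k" "qcategory Q B" "qcategory Q A"
    and "\<And>a. a \<in> objs A \<Longrightarrow> \<phi> a \<in> carrier (Hom Q C (ty A a))" "a \<in> objs A"
  shows "\<phi> a \<sqsubseteq>\<^bsub>Hom Q C (ty A a)\<^esub> hom B (F a) k"
proof -
  have "k \<in> objs B" "ty B k = C" using assms(1) by (auto simp: colim_obj_def)
  then show ?thesis
    using qcategory.hom_unit[OF assms(2), of k] colim_obj_le_iff[OF assms(1-3) _ _ assms(4), of k] assms(5)
    by auto
qed

lemma colim_obj_unique:
  assumes "colim_obj Q A B C \<phi> F k" "colim_obj Q A B C \<phi> F k'" "qcategory Q B" "qcategory Q A"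
    and "\<And>a. a \<in> objs A \<Longrightarrow> \<phi> a \<in> carrier (Hom Q C (ty A a))"
  shows "Id Q C \<sqsubseteq>\<^bsub>Hom Q C C\<^esub> hom B k k'"
proof -
  have "k' \<in> objs B" "ty B k' = C" using assms(2) by (auto simp: colim_obj_def)
  moreover have "\<forall>a\<in>objs A. \<phi> a \<sqsubseteq>\<^bsub>Hom Q C (ty A a)\<^esub> hom B (F a) k'"
    using colim_obj_unit[OF assms(2-5)] by blast
  ultimately show ?thesis using colim_obj_le_iff[OF assms(1,3,4) _ _ assms(5)] by blast
qed

lemma colim_obj_iso:
  assumes k: "colim_obj Q A B C \<phi> F k" and B: "qcategory Q B"
    and k': "k' \<in> objs B" "ty B k' = C"
    and le: "Id Q C \<sqsubseteq>\<^bsub>Hom Q C C\<^esub> hom B k k'" "Id Q C \<sqsubseteq>\<^bsub>Hom Q C C\<^esub> hom B k' k"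
  shows "colim_obj Q A B C \<phi> F k'"
proof -
  interpret qcategory Q B by fact
  have k_objs: "k \<in> objs B" "ty B k = C" using k by (auto simp: colim_obj_def)
  have "hom B k' b = hom B k b" if b: "b \<in> objs B" for b
    using b k' k_objs le hom_closed[of b k] hom_closed[of b k'] hom_mono_left[of k k' b]
      hom_mono_left[of k' k b]
    by (intro le_antisym[of "ty B b" C]) (auto intro: ty_closed)
  then show ?thesis using k k' by (simp add: colim_obj_def)
qed

text \<open>
  The defining equation of a colimit says the same thing separately for every object \<open>c\<close> of the
  domain of the weight. That objects \<open>K c\<close> found one at a time assemble to a functor is a
  consequence of their universal property: \<open>\<Theta>(a,c') \<circ> C(c',c) \<le> \<Theta>(a,c) \<le> B(Fa,K c)\<close> for all \<open>a\<close>
  gives \<open>C(c',c) \<le> B(K c',K c)\<close>.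
\<close>

lemma is_colim_iff:
  "is_colim Q C A B \<Theta> F K \<longleftrightarrow>
     distributor Q C A \<Theta> \<and> qfunctor Q A B F \<and>
     (\<forall>c\<in>objs C. colim_obj Q A B (ty C c) (\<lambda>a. \<Theta> (a, c)) F (K c))"
proof (cases "distributor Q C A \<Theta> \<and> qfunctor Q A B F")
  case True
  then interpret \<Theta>: distributor Q C A \<Theta> by blast
  interpret F: qfunctor Q A B F using True by blast
  note closed = \<Theta>.dom.hom_closed \<Theta>.dom.ty_closed \<Theta>.cod.ty_closed F.cod.ty_closed
    F.hom_closed' distributor_closed[OF \<Theta>.distributor_axioms]
  note conjF = conjoint_distributor[OF F.qfunctor_axioms]
  note lift = dist_lift_distributor[OF F.cod.qcategory_axioms \<Theta>.distributor_axioms conjF]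
    le_dist_lift_iff[OF F.cod.qcategory_axioms \<Theta>.distributor_axioms conjF]
  have *: "conjoint C B K = dist_lift Q B C A \<Theta> (conjoint A B F) \<longleftrightarrow>
      (\<forall>c\<in>objs C. colim_obj Q A B (ty C c) (\<lambda>a. \<Theta> (a, c)) F (K c))"
    if K: "qfunctor Q C B K"
  proof -
    interpret K: qfunctor Q C B K by fact
    show ?thesis
    proof
      assume eq: "conjoint C B K = dist_lift Q B C A \<Theta> (conjoint A B F)"
      show "\<forall>c\<in>objs C. colim_obj Q A B (ty C c) (\<lambda>a. \<Theta> (a, c)) F (K c)"
        unfolding colim_obj_def
      proof (intro ballI conjI, goal_cases)
        case (3 c b x)
        then show ?case using lift(2)[of b c x]
          unfolding eq[symmetric] by (simp add: conjoint_def)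
      qed (auto simp: K.maps K.ty_preserving)
    next
      assume *: "\<forall>c\<in>objs C. colim_obj Q A B (ty C c) (\<lambda>a. \<Theta> (a, c)) F (K c)"
      show "conjoint C B K = dist_lift Q B C A \<Theta> (conjoint A B F)"
      proof (rule distributor_eqI[OF conjoint_distributor[OF K] lift(1)], goal_cases)
        case (1 b c x)
        then show ?case
          using colim_obj_iff[OF *[rule_format, of c], of b x] lift(2)[of b c x]
          by (simp add: conjoint_def)
      qed
    qed
  qed
  have "qfunctor Q C B K"
    if k: "\<forall>c\<in>objs C. colim_obj Q A B (ty C c) (\<lambda>a. \<Theta> (a, c)) F (K c)"
  proof (unfold_locales, goal_cases)
    case 1
    then show ?case using k by (auto simp: colim_obj_def)
  next
    case (2 c)
    then show ?case using k by (auto simp: colim_obj_def)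
  next
    case (3 c c')
    have K: "K c \<in> objs B" "ty B (K c) = ty C c" using k 3 by (auto simp: colim_obj_def)
    have "Comp Q (ty C c) (ty C c') (ty A a) (\<Theta> (a, c')) (hom C c' c)
        \<sqsubseteq>\<^bsub>Hom Q (ty C c) (ty A a)\<^esub> hom B (F a) (K c)" if a: "a \<in> objs A" for a
    proof (rule \<Theta>.dom.le_trans[OF _ _ _ _ _ \<Theta>.right_action])
      show "\<Theta> (a, c) \<sqsubseteq>\<^bsub>Hom Q (ty C c) (ty A a)\<^esub> hom B (F a) (K c)"
        using colim_obj_unit[OF k[rule_format, OF 3(1)] F.cod.qcategory_axioms \<Theta>.cod.qcategory_axioms]
          a 3 by (auto intro: closed)
    qed (use a 3 K F.hom_closed'[of a "K c"] in \<open>auto intro!: closed \<Theta>.dom.Comp_closed\<close>)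
    then show ?case
      using colim_obj_iff[OF k[rule_format, OF 3(2)] K(1), of "hom C c' c"] K(2) 3
      by (simp add: closed)
  qed
  with * True show ?thesis unfolding is_colim_def by blast
qed (auto simp: is_colim_def)

section \<open>Kan extensions and adjoints\<close>

lemma qfunctor_id:
  assumes "qcategory Q A"
  shows "qfunctor Q A A id"
proof -
  interpret qcategory Q A by fact
  show ?thesis by unfold_locales (auto intro: le_refl hom_closed ty_closed)
qed

lemma qfunctor_comp:
  assumes "qfunctor Q A B F" "qfunctor Q B C G"
  shows "qfunctor Q A C (G \<circ> F)"
proof -
  interpret F: qfunctor Q A B F by fact
  interpret G: qfunctor Q B C G by fact
  show ?thesis
  proof (unfold_locales, goal_cases)
    case (3 a a')
    have 1: "hom A a' a \<sqsubseteq>\<^bsub>Hom Q (ty A a) (ty A a')\<^esub> hom B (F a') (F a)"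
      using 3 by (rule F.hom_le)
    have 2: "hom B (F a') (F a) \<sqsubseteq>\<^bsub>Hom Q (ty A a) (ty A a')\<^esub> hom C (G (F a')) (G (F a))"
      using G.hom_le[of "F a" "F a'"] 3 by (simp add: F.maps F.ty_preserving)
    have "hom B (F a') (F a) \<in> carrier (Hom Q (ty A a) (ty A a'))"
      "hom C (G (F a')) (G (F a)) \<in> carrier (Hom Q (ty A a) (ty A a'))"
      using F.hom_closed'(1)[of a' "F a"] G.hom_closed'(1)[of "F a'" "G (F a)"] 3
      by (simp_all add: F.maps G.maps F.ty_preserving G.ty_preserving)
    with 3 have "hom A a' a \<sqsubseteq>\<^bsub>Hom Q (ty A a) (ty A a')\<^esub> hom C (G (F a')) (G (F a))"
      by (intro F.dom.le_trans[OF _ _ _ _ _ 1 2] F.dom.ty_closed F.dom.hom_closed)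
    then show ?case by simp
  qed (auto simp: F.maps G.maps F.ty_preserving G.ty_preserving)
qed

lemma functor_leD:
  assumes "functor_le Q A B F G" "qfunctor Q A B F" "qfunctor Q A B G" "a \<in> objs A" "b \<in> objs B"
  shows "hom B b (F a) \<sqsubseteq>\<^bsub>Hom Q (ty A a) (ty B b)\<^esub> hom B b (G a)"
    and "hom B (G a) b \<sqsubseteq>\<^bsub>Hom Q (ty B b) (ty A a)\<^esub> hom B (F a) b"
proof -
  interpret F: qfunctor Q A B F by fact
  interpret G: qfunctor Q A B G by fact
  have "Id Q (ty B (F a)) \<sqsubseteq>\<^bsub>Hom Q (ty B (F a)) (ty B (F a))\<^esub> hom B (F a) (G a)"
    using assms by (simp add: functor_le_def F.ty_preserving)
  then show "hom B b (F a) \<sqsubseteq>\<^bsub>Hom Q (ty A a) (ty B b)\<^esub> hom B b (G a)"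
    and "hom B (G a) b \<sqsubseteq>\<^bsub>Hom Q (ty B b) (ty A a)\<^esub> hom B (F a) b"
    using F.cod.hom_mono_right[of "F a" "G a" b] F.cod.hom_mono_left[of "F a" "G a" b] assms
    by (simp_all add: F.maps G.maps F.ty_preserving G.ty_preserving)
qed

lemma functor_le_trans:
  assumes "qfunctor Q A B F" "qfunctor Q A B G" "qfunctor Q A B H"
    and "functor_le Q A B F G" "functor_le Q A B G H"
  shows "functor_le Q A B F H"
  unfolding functor_le_def
proof
  interpret F: qfunctor Q A B F by fact
  interpret G: qfunctor Q A B G by fact
  interpret H: qfunctor Q A B H by fact
  fix a assume a: "a \<in> objs A"
  show "Id Q (ty A a) \<sqsubseteq>\<^bsub>Hom Q (ty A a) (ty A a)\<^esub> hom B (F a) (H a)"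
  proof (rule F.dom.le_trans)
    show "Id Q (ty A a) \<sqsubseteq>\<^bsub>Hom Q (ty A a) (ty A a)\<^esub> hom B (F a) (G a)"
      using assms a by (simp add: functor_le_def)
    show "hom B (F a) (G a) \<sqsubseteq>\<^bsub>Hom Q (ty A a) (ty A a)\<^esub> hom B (F a) (H a)"
      using functor_leD(1)[OF assms(5,2,3) a F.maps[OF a]] a by (simp add: F.ty_preserving)
  qed (use a F.hom_closed'(1)[of a "G a"] F.hom_closed'(1)[of a "H a"] in
        \<open>auto intro: F.dom.Id_closed F.dom.ty_closed simp: G.maps H.maps G.ty_preserving H.ty_preserving\<close>)
qed

lemma functor_le_whisker:
  assumes "qfunctor Q C B K" "qfunctor Q A C F" "qfunctor Q A C G" "functor_le Q A C F G"
  shows "functor_le Q A B (K \<circ> F) (K \<circ> G)"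
  unfolding functor_le_def
proof
  interpret K: qfunctor Q C B K by fact
  interpret F: qfunctor Q A C F by fact
  interpret G: qfunctor Q A C G by fact
  fix a assume a: "a \<in> objs A"
  show "Id Q (ty A a) \<sqsubseteq>\<^bsub>Hom Q (ty A a) (ty A a)\<^esub> hom B ((K \<circ> F) a) ((K \<circ> G) a)"
  proof (rule K.dom.le_trans)
    show "Id Q (ty A a) \<sqsubseteq>\<^bsub>Hom Q (ty A a) (ty A a)\<^esub> hom C (F a) (G a)"
      using assms(4) a by (simp add: functor_le_def)
    show "hom C (F a) (G a) \<sqsubseteq>\<^bsub>Hom Q (ty A a) (ty A a)\<^esub> hom B ((K \<circ> F) a) ((K \<circ> G) a)"
      using K.hom_le[of "G a" "F a"] a
      by (simp add: F.maps G.maps F.ty_preserving G.ty_preserving)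
  qed (use a F.hom_closed'(1)[of a "G a"] K.hom_closed'(1)[of "F a" "K (G a)"] in
        \<open>auto intro: K.dom.Id_closed F.dom.ty_closed
          simp: K.maps F.maps G.maps F.ty_preserving G.ty_preserving K.ty_preserving\<close>)
qed

lemma is_lan_unique:
  assumes "is_lan Q A B C F G K" "is_lan Q A B C F G K'"
  shows "functor_le Q C B K K'"
  using assms unfolding is_lan_def by blast

lemma is_colim_conjoint_iff:
  assumes "qfunctor Q A B F" "qfunctor Q A C G"
  shows "is_colim Q C A B (conjoint A C G) F K \<longleftrightarrow>
    (\<forall>c\<in>objs C. colim_obj Q A B (ty C c) (\<lambda>a. hom C (G a) c) F (K c))"
proof -
  have "colim_obj Q A B (ty C c) (\<lambda>a. conjoint A C G (a, c)) F (K c) \<longleftrightarrow>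
      colim_obj Q A B (ty C c) (\<lambda>a. hom C (G a) c) F (K c)" if "c \<in> objs C" for c
    using that by (simp add: colim_obj_def conjoint_def)
  then show ?thesis
    using assms conjoint_distributor[OF assms(2)] by (simp add: is_colim_iff)
qed

text \<open>
  A cocone under \<open>F\<close> with weight \<open>C(G-,c)\<close> and vertex \<open>K' c\<close> is what \<open>F \<le> K' \<circ> G\<close> provides,
  by functoriality of \<open>K'\<close>.
\<close>

lemma is_lan_colim:
  assumes F: "qfunctor Q A B F" and G: "qfunctor Q A C G"
    and K: "is_colim Q C A B (conjoint A C G) F K"
  shows "is_lan Q A B C F G K"
proof -
  interpret F: qfunctor Q A B F by fact
  interpret G: qfunctor Q A C G by fact
  have K_fun: "qfunctor Q C B K" using K by (simp add: is_colim_def)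
  interpret K: qfunctor Q C B K by fact
  have colim: "colim_obj Q A B (ty C c) (\<lambda>a. hom C (G a) c) F (K c)" if "c \<in> objs C" for c
    using K that is_colim_conjoint_iff[OF F G] by blast
  have A: "qcategory Q A" and B: "qcategory Q B" using F by (simp_all add: qfunctor_def)
  show ?thesis unfolding is_lan_def
  proof (intro conjI F G K_fun allI impI)
    show "functor_le Q A B F (K \<circ> G)" unfolding functor_le_def
    proof
      fix a assume a: "a \<in> objs A"
      have "hom C (G a) (G a) \<sqsubseteq>\<^bsub>Hom Q (ty A a) (ty A a)\<^esub> hom B (F a) (K (G a))"
        using colim_obj_unit[OF colim[OF G.maps[OF a]] B A G.hom_closed'(1)[OF _ G.maps[OF a]] a] a
        by (simp add: G.ty_preserving)
      moreover have "Id Q (ty A a) \<sqsubseteq>\<^bsub>Hom Q (ty A a) (ty A a)\<^esub> hom C (G a) (G a)"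
        using qcategory.hom_unit[OF qfunctor.axioms(2)[OF G], of "G a"] a by (simp add: G.maps G.ty_preserving)
      moreover have "ty A a \<in> Obj Q" "Id Q (ty A a) \<in> carrier (Hom Q (ty A a) (ty A a))"
        "hom C (G a) (G a) \<in> carrier (Hom Q (ty A a) (ty A a))"
        "hom B (F a) (K (G a)) \<in> carrier (Hom Q (ty A a) (ty A a))"
        using a F.hom_closed'(1)[of a "K (G a)"] G.hom_closed'(1)[of a "G a"]
        by (simp_all add: G.maps K.maps G.ty_preserving K.ty_preserving F.dom.Id_closed F.dom.ty_closed)
      ultimately show "Id Q (ty A a) \<sqsubseteq>\<^bsub>Hom Q (ty A a) (ty A a)\<^esub> hom B (F a) ((K \<circ> G) a)"
        using F.dom.le_trans[of "ty A a" "ty A a" "Id Q (ty A a)" "hom C (G a) (G a)" "hom B (F a) (K (G a))"]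
        by simp
    qed
  next
    fix K' assume K': "qfunctor Q C B K'" and le: "functor_le Q A B F (K' \<circ> G)"
    interpret K': qfunctor Q C B K' by fact
    show "functor_le Q C B K K'" unfolding functor_le_def
    proof
      fix c assume c: "c \<in> objs C"
      have "hom C (G a) c \<sqsubseteq>\<^bsub>Hom Q (ty C c) (ty A a)\<^esub> hom B (F a) (K' c)" if a: "a \<in> objs A" for a
      proof (rule F.dom.le_trans)
        show "hom C (G a) c \<sqsubseteq>\<^bsub>Hom Q (ty C c) (ty A a)\<^esub> hom B (K' (G a)) (K' c)"
          using K'.hom_le[of c "G a"] a c by (simp add: G.maps G.ty_preserving)
        show "hom B (K' (G a)) (K' c) \<sqsubseteq>\<^bsub>Hom Q (ty C c) (ty A a)\<^esub> hom B (F a) (K' c)"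
          using functor_leD(2)[OF le F qfunctor_comp[OF G K'] a, of "K' c"] c
          by (simp add: K'.maps K'.ty_preserving)
      qed (use a c F.hom_closed'(1)[of a "K' c"] G.hom_closed'(1)[of a c] K'.hom_closed'(1)[of "G a" "K' c"] in
            \<open>auto intro: F.dom.ty_closed G.cod.ty_closed simp: K'.maps G.maps K'.ty_preserving G.ty_preserving\<close>)
      then show "Id Q (ty C c) \<sqsubseteq>\<^bsub>Hom Q (ty C c) (ty C c)\<^esub> hom B (K c) (K' c)"
        using colim_obj_le_iff[OF colim[OF c] B A K'.maps[OF c] K'.ty_preserving[OF c] G.hom_closed'(1)[OF _ c]]
        by blast
    qed
  qed
qed

lemma left_adjoint_hom_eq:
  assumes adj: "left_adjoint Q A B F G" and a: "a \<in> objs A" and b: "b \<in> objs B"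
  shows "hom B (F a) b = hom A a (G b)"
proof -
  have F: "qfunctor Q A B F" and G: "qfunctor Q B A G"
    and unit: "functor_le Q A A id (G \<circ> F)" and counit: "functor_le Q B B (F \<circ> G) id"
    using adj by (auto simp: left_adjoint_def)
  interpret F: qfunctor Q A B F by fact
  interpret G: qfunctor Q B A G by fact
  have A: "qcategory Q A" and B: "qcategory Q B" using F by (simp_all add: qfunctor_def)
  have le1: "hom B (F a) b \<sqsubseteq>\<^bsub>Hom Q (ty B b) (ty A a)\<^esub> hom A (G (F a)) (G b)"
    using G.hom_le[of b "F a"] a b by (simp add: F.maps F.ty_preserving)
  have le2: "hom A (G (F a)) (G b) \<sqsubseteq>\<^bsub>Hom Q (ty B b) (ty A a)\<^esub> hom A a (G b)"
    using functor_leD(2)[OF unit qfunctor_id[OF A] qfunctor_comp[OF F G] a, of "G b"] b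
    by (simp add: G.maps G.ty_preserving)
  have le3: "hom A a (G b) \<sqsubseteq>\<^bsub>Hom Q (ty B b) (ty A a)\<^esub> hom B (F a) (F (G b))"
    using F.hom_le[of "G b" a] a b by (simp add: G.maps G.ty_preserving)
  have le4: "hom B (F a) (F (G b)) \<sqsubseteq>\<^bsub>Hom Q (ty B b) (ty A a)\<^esub> hom B (F a) b"
    using functor_leD(1)[OF counit qfunctor_comp[OF G F] qfunctor_id[OF B] b, of "F a"] a
    by (simp add: F.maps F.ty_preserving)
  have objs: "ty B b \<in> Obj Q" "ty A a \<in> Obj Q" "hom B (F a) b \<in> carrier (Hom Q (ty B b) (ty A a))"
    "hom A (G (F a)) (G b) \<in> carrier (Hom Q (ty B b) (ty A a))"
    "hom A a (G b) \<in> carrier (Hom Q (ty B b) (ty A a))"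
    "hom B (F a) (F (G b)) \<in> carrier (Hom Q (ty B b) (ty A a))"
    using a b F.hom_closed'(1)[of a b] F.hom_closed'(1)[of a "F (G b)"] G.hom_closed'(2)[of b a]
      G.hom_closed'(1)[of "F a" "G b"]
    by (auto simp: F.maps G.maps F.ty_preserving G.ty_preserving qcategory.ty_closed[OF A] qcategory.ty_closed[OF B])
  show ?thesis
    by (rule F.dom.le_antisym[OF objs(1,2,3,5)])
       (rule F.dom.le_trans[OF objs(1,2,3,4,5) le1 le2] F.dom.le_trans[OF objs(1,2,5,6,3) le3 le4])+
qed

lemma functor_iso_refl:
  assumes "qfunctor Q A B F"
  shows "functor_iso Q A B F F"
proof -
  interpret qfunctor Q A B F by fact
  have "Id Q (ty A a) \<sqsubseteq>\<^bsub>Hom Q (ty A a) (ty A a)\<^esub> hom B (F a) (F a)" if "a \<in> objs A" for a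
    using cod.hom_unit[OF maps[OF that]] that by (simp add: ty_preserving)
  then show ?thesis by (simp add: functor_iso_def functor_le_def)
qed

text \<open>
  Under the identity \<open>B(Fa,b) = A(a,Gb)\<close> the universal property of a colimit \<open>K c\<close>, tested at
  the objects \<open>G b\<close>, is the universal property of \<open>F (K c)\<close>.
\<close>

lemma left_adjoint_cocontinuous:
  fixes A :: "('a, 'o, 'm) qcat" and B :: "('b, 'o, 'm) qcat"
  assumes adj: "left_adjoint Q A B F G"
  shows "cocontinuous TYPE('c) TYPE('d) Q A B F"
  unfolding cocontinuous_def
proof (intro conjI allI impI)
  have F: "qfunctor Q A B F" and G: "qfunctor Q B A G" using adj by (auto simp: left_adjoint_def)
  show "qfunctor Q A B F" by fact
  interpret F: qfunctor Q A B F by fact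
  interpret G: qfunctor Q B A G by fact
  fix C :: "('c, 'o, 'm) qcat" and D :: "('d, 'o, 'm) qcat" and \<Theta> H K
  assume colim: "is_colim Q C D A \<Theta> H K"
  then have \<Theta>: "distributor Q C D \<Theta>" and H: "qfunctor Q D A H" and K: "qfunctor Q C A K"
    by (auto simp: is_colim_def)
  interpret H: qfunctor Q D A H by fact
  have "is_colim Q C D B \<Theta> (F \<circ> H) (F \<circ> K)"
    unfolding is_colim_iff
  proof (intro conjI \<Theta> qfunctor_comp[OF H F] ballI)
    fix c assume c: "c \<in> objs C"
    have k: "colim_obj Q D A (ty C c) (\<lambda>d. \<Theta> (d, c)) H (K c)"
      using colim c by (simp add: is_colim_iff)
    then have K: "K c \<in> objs A" "ty A (K c) = ty C c" by (auto simp: colim_obj_def)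
    show "colim_obj Q D B (ty C c) (\<lambda>d. \<Theta> (d, c)) (F \<circ> H) ((F \<circ> K) c)"
      unfolding colim_obj_def
      using K colim_obj_iff[OF k G.maps]
      by (auto simp: F.maps F.ty_preserving G.ty_preserving H.maps left_adjoint_hom_eq[OF adj])
  qed
  then show "\<exists>L. is_colim Q C D B \<Theta> (F \<circ> H) L \<and> functor_iso Q C B L (F \<circ> K)"
    using functor_iso_refl[OF qfunctor_comp[OF K F]] by blast
qed

section \<open>Presheaves\<close>

lemma star_qcategory:
  assumes "quantaloid Q" "C \<in> Obj Q"
  shows "qcategory Q (star Q C)"
proof -
  interpret quantaloid Q by fact
  show ?thesis
    by unfold_locales (auto simp: star_def assms Id_closed Comp_Id_right le_refl)
qed

lemma star_simps [simp]:
  "objs (star Q C) = {()}" "ty (star Q C) u = C" "hom (star Q C) u v = Id Q C"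
  by (simp_all add: star_def)

lemma objs_PSh_iff:
  "p \<in> objs (PSh Q A) \<longleftrightarrow> fst p \<in> Obj Q \<and> distributor Q (star Q (fst p)) A (snd p)"
  by (auto simp: PSh_def)

lemma ty_PSh [simp]: "ty (PSh Q A) p = fst p"
  by (simp add: PSh_def)

lemma PSh_closed:
  assumes "p \<in> objs (PSh Q A)" "a \<in> objs A"
  shows "snd p (a, ()) \<in> carrier (Hom Q (fst p) (ty A a))"
  using distributor_closed[of Q "star Q (fst p)" A "snd p" "()" a] assms by (simp add: objs_PSh_iff)

lemma hom_PSh:
  assumes Q: "quantaloid Q" and p: "p \<in> objs (PSh Q A)" and p': "p' \<in> objs (PSh Q A)"
  shows hom_PSh_closed: "hom (PSh Q A) p' p \<in> carrier (Hom Q (fst p) (fst p'))"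
    and le_hom_PSh_iff: "x \<in> carrier (Hom Q (fst p) (fst p')) \<Longrightarrow>
      x \<sqsubseteq>\<^bsub>Hom Q (fst p) (fst p')\<^esub> hom (PSh Q A) p' p \<longleftrightarrow>
        (\<forall>a\<in>objs A. Comp Q (fst p) (fst p') (ty A a) (snd p' (a, ())) x
          \<sqsubseteq>\<^bsub>Hom Q (fst p) (ty A a)\<^esub> snd p (a, ()))"
proof -
  have d: "distributor Q (star Q (fst p)) A (snd p)" "distributor Q (star Q (fst p')) A (snd p')"
    and C: "fst p \<in> Obj Q"
    using p p' by (auto simp: objs_PSh_iff)
  have hom: "hom (PSh Q A) p' p
      = dist_lift Q (star Q (fst p)) (star Q (fst p')) A (snd p') (snd p) ((), ())"
    by (simp add: PSh_def split: prod.splits)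
  note lift = dist_lift_distributor[OF star_qcategory[OF Q C] d(2,1)]
    le_dist_lift_iff[OF star_qcategory[OF Q C] d(2,1)]
  show "hom (PSh Q A) p' p \<in> carrier (Hom Q (fst p) (fst p'))"
    using distributor_closed[OF lift(1), of "()" "()"] by (simp add: hom)
  show "x \<in> carrier (Hom Q (fst p) (fst p')) \<Longrightarrow>
      x \<sqsubseteq>\<^bsub>Hom Q (fst p) (fst p')\<^esub> hom (PSh Q A) p' p \<longleftrightarrow>
        (\<forall>a\<in>objs A. Comp Q (fst p) (fst p') (ty A a) (snd p' (a, ())) x
          \<sqsubseteq>\<^bsub>Hom Q (fst p) (ty A a)\<^esub> snd p (a, ()))"
    using lift(2)[of "()" "()" x] by (simp add: hom)
qed

lemma hom_PSh_eval:
  assumes Q: "quantaloid Q" and p: "p \<in> objs (PSh Q A)" and p': "p' \<in> objs (PSh Q A)"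
    and a: "a \<in> objs A"
  shows "Comp Q (fst p) (fst p') (ty A a) (snd p' (a, ())) (hom (PSh Q A) p' p)
          \<sqsubseteq>\<^bsub>Hom Q (fst p) (ty A a)\<^esub> snd p (a, ())"
proof -
  have "hom (PSh Q A) p' p \<sqsubseteq>\<^bsub>Hom Q (fst p) (fst p')\<^esub> hom (PSh Q A) p' p"
    using p p' by (intro quantaloid.le_refl[OF Q] hom_PSh_closed[OF Q]) (auto simp: objs_PSh_iff)
  then show ?thesis using le_hom_PSh_iff[OF Q p p' hom_PSh_closed[OF Q p p']] a by blast
qed

lemma PSh_qcategory:
  assumes A: "qcategory Q A"
  shows "qcategory Q (PSh Q A)"
proof -
  interpret qcategory Q A by fact
  note Q = quantaloid_axioms
  show ?thesis
  proof (unfold_locales, goal_cases)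
    case (1 p)
    then show ?case by (simp add: objs_PSh_iff)
  next
    case (2 p p')
    then show ?case by (simp add: hom_PSh_closed[OF Q])
  next
    case (3 p p' p'')
    let ?P = "hom (PSh Q A)"
    have objs: "fst p \<in> Obj Q" "fst p' \<in> Obj Q" "fst p'' \<in> Obj Q" using 3 by (auto simp: objs_PSh_iff)
    have closed: "?P p'' p' \<in> carrier (Hom Q (fst p') (fst p''))" "?P p' p \<in> carrier (Hom Q (fst p) (fst p'))"
      using 3 by (auto intro: hom_PSh_closed[OF Q])
    have "Comp Q (fst p) (fst p'') (ty A a) (snd p'' (a, ()))
        (Comp Q (fst p) (fst p') (fst p'') (?P p'' p') (?P p' p))
        \<sqsubseteq>\<^bsub>Hom Q (fst p) (ty A a)\<^esub> snd p (a, ())" if a: "a \<in> objs A" for a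
    proof -
      have eq: "Comp Q (fst p) (fst p'') (ty A a) (snd p'' (a, ()))
          (Comp Q (fst p) (fst p') (fst p'') (?P p'' p') (?P p' p))
        = Comp Q (fst p) (fst p') (ty A a)
          (Comp Q (fst p') (fst p'') (ty A a) (snd p'' (a, ())) (?P p'' p')) (?P p' p)"
        using objs closed a 3 by (intro Comp_assoc) (auto intro: PSh_closed ty_closed)
      have le: "\<dots> \<sqsubseteq>\<^bsub>Hom Q (fst p) (ty A a)\<^esub>
          Comp Q (fst p) (fst p') (ty A a) (snd p' (a, ())) (?P p' p)"
        using objs closed a 3 by (intro Comp_mono hom_PSh_eval[OF Q])
           (auto intro: PSh_closed ty_closed Comp_closed le_refl)
      show ?thesis unfolding eq
        by (rule le_trans[OF _ _ _ _ _ le hom_PSh_eval[OF Q]])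
           (use objs closed a 3 in \<open>auto intro!: PSh_closed ty_closed Comp_closed\<close>)
    qed
    then show ?case
      using 3 objs closed by (simp add: le_hom_PSh_iff[OF Q] Comp_closed)
  next
    case (4 p)
    then have "fst p \<in> Obj Q" by (simp add: objs_PSh_iff)
    with 4 show ?case
      using PSh_closed[OF 4]
      by (simp add: le_hom_PSh_iff[OF Q] Id_closed Comp_Id_right ty_closed le_refl)
  qed
qed

text \<open>
  The Yoneda embedding of \<open>B\<close> restricted along \<open>F\<close>. The Yoneda embedding of \<open>A\<close> is the nerve of the
  identity functor, so that its basic properties are instances of those of nerves.
\<close>

definition nerve :: "('a, 'o, 'm) qcat \<Rightarrow> ('b, 'o, 'm) qcat \<Rightarrow> ('a \<Rightarrow> 'b) \<Rightarrow> 'b \<Rightarrow> 'o \<times> ('a \<times> unit \<Rightarrow> 'm)"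
  where "nerve A B F b = (ty B b, \<lambda>(a, u) \<in> objs A \<times> {()}. hom B (F a) b)"

lemma yoneda_eq_nerve: "yoneda A = nerve A A id"
  by (simp add: fun_eq_iff yoneda_def nerve_def)

lemma fst_nerve [simp]: "fst (nerve A B F b) = ty B b"
  and snd_nerve [simp]: "a \<in> objs A \<Longrightarrow> snd (nerve A B F b) (a, ()) = hom B (F a) b"
  by (simp_all add: nerve_def)

lemma nerve_objs:
  assumes F: "qfunctor Q A B F" and b: "b \<in> objs B"
  shows "nerve A B F b \<in> objs (PSh Q A)"
proof -
  interpret qfunctor Q A B F by fact
  have tb: "ty B b \<in> Obj Q" using b by (rule cod.ty_closed)
  interpret star: qcategory Q "star Q (ty B b)"
    by (rule star_qcategory[OF dom.quantaloid_axioms tb])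
  interpret conj: distributor Q B A "conjoint A B F"
    by (rule conjoint_distributor[OF F])
  have "distributor Q (star Q (ty B b)) A (\<lambda>(a, u) \<in> objs A \<times> {()}. hom B (F a) b)"
  proof (unfold_locales, goal_cases)
    case 1
    show ?case unfolding star_simps restrict_PiE_iff using b by (auto intro: hom_closed')
  next
    case (2 u a a')
    then show ?case using conj.left_action[OF b, of a a'] b by (simp add: conjoint_def)
  next
    case (3 u v a)
    then show ?case using hom_closed'(1)[of a b] b tb
      by (simp add: dom.Comp_Id_right dom.ty_closed dom.le_refl)
  qed
  then show ?thesis using tb by (simp add: objs_PSh_iff nerve_def)
qed

lemma le_hom_PSh_nerve_iff:
  assumes F: "qfunctor Q A B F" and b: "b \<in> objs B" and p: "p \<in> objs (PSh Q A)"
    and x: "x \<in> carrier (Hom Q (ty B b) (fst p))"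
  shows "x \<sqsubseteq>\<^bsub>Hom Q (ty B b) (fst p)\<^esub> hom (PSh Q A) p (nerve A B F b) \<longleftrightarrow>
    (\<forall>a\<in>objs A. Comp Q (ty B b) (fst p) (ty A a) (snd p (a, ())) x
       \<sqsubseteq>\<^bsub>Hom Q (ty B b) (ty A a)\<^esub> hom B (F a) b)"
proof -
  interpret qfunctor Q A B F by fact
  show ?thesis
    using le_hom_PSh_iff[OF dom.quantaloid_axioms nerve_objs[OF F b] p, of x] x by simp
qed

lemma nerve_functor:
  assumes F: "qfunctor Q A B F"
  shows "qfunctor Q B (PSh Q A) (nerve A B F)"
proof -
  interpret qfunctor Q A B F by fact
  interpret P: qcategory Q "PSh Q A" by (rule PSh_qcategory[OF dom.qcategory_axioms])
  show ?thesis
  proof (unfold_locales, goal_cases)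
    case (3 b b')
    have "Comp Q (ty B b) (ty B b') (ty A a) (hom B (F a) b') (hom B b' b)
        \<sqsubseteq>\<^bsub>Hom Q (ty B b) (ty A a)\<^esub> hom B (F a) b" if "a \<in> objs A" for a
      using cod.hom_comp[OF 3 maps[OF that]] that by (simp add: ty_preserving)
    then show ?case
      using le_hom_PSh_nerve_iff[OF F 3(1) nerve_objs[OF F 3(2)], of "hom B b' b"]
        cod.hom_closed[OF 3] by simp
  qed (auto simp: nerve_objs[OF F])
qed

lemma yoneda_functor:
  assumes "qcategory Q A"
  shows "qfunctor Q A (PSh Q A) (yoneda A)"
  unfolding yoneda_eq_nerve by (rule nerve_functor[OF qfunctor_id[OF assms]])

text \<open>
  An arrow \<open>x\<close> below \<open>\<phi>(a)\<close> satisfies \<open>A(a',a) \<circ> x \<le> \<phi>(a')\<close> by the action of \<open>A\<close> on \<open>\<phi>\<close>; conversely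
  the case \<open>a' = a\<close> together with \<open>1 \<le> A(a,a)\<close> gives \<open>x \<le> \<phi>(a)\<close>.
\<close>

lemma yoneda_lemma:
  assumes A: "qcategory Q A" and a: "a \<in> objs A" and p: "p \<in> objs (PSh Q A)"
  shows "hom (PSh Q A) (yoneda A a) p = snd p (a, ())"
proof -
  interpret qcategory Q A by fact
  note Q = quantaloid_axioms
  have C: "fst p \<in> Obj Q" and dist: "distributor Q (star Q (fst p)) A (snd p)"
    using p by (auto simp: objs_PSh_iff)
  have Y: "yoneda A a \<in> objs (PSh Q A)" "fst (yoneda A a) = ty A a"
    "\<And>a'. a' \<in> objs A \<Longrightarrow> snd (yoneda A a) (a', ()) = hom A a' a"
    using nerve_objs[OF qfunctor_id[OF A] a] by (simp_all add: yoneda_eq_nerve)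
  have pa: "snd p (a', ()) \<in> carrier (Hom Q (fst p) (ty A a'))" if "a' \<in> objs A" for a'
    using PSh_closed[OF p that] .
  note closed = pa ty_closed hom_closed Comp_closed Id_closed
  show ?thesis
  proof (rule eqI_lower[of "fst p" "ty A a"])
    fix x assume x: "x \<in> carrier (Hom Q (fst p) (ty A a))"
    have "(\<forall>a'\<in>objs A. Comp Q (fst p) (ty A a) (ty A a') (hom A a' a) x
          \<sqsubseteq>\<^bsub>Hom Q (fst p) (ty A a')\<^esub> snd p (a', ())) \<longleftrightarrow> x \<sqsubseteq>\<^bsub>Hom Q (fst p) (ty A a)\<^esub> snd p (a, ())"
    proof (intro iffI ballI)
      assume *: "\<forall>a'\<in>objs A. Comp Q (fst p) (ty A a) (ty A a') (hom A a' a) x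
          \<sqsubseteq>\<^bsub>Hom Q (fst p) (ty A a')\<^esub> snd p (a', ())"
      have 1: "Comp Q (fst p) (ty A a) (ty A a) (Id Q (ty A a)) x
          \<sqsubseteq>\<^bsub>Hom Q (fst p) (ty A a)\<^esub> Comp Q (fst p) (ty A a) (ty A a) (hom A a a) x"
        using a x C by (intro Comp_mono hom_unit le_refl) (auto intro: closed)
      show "x \<sqsubseteq>\<^bsub>Hom Q (fst p) (ty A a)\<^esub> snd p (a, ())"
        using le_trans[OF _ _ _ _ _ 1 *[rule_format, OF a]] a x C
        by (simp add: Comp_Id_left closed)
    next
      fix a' assume le: "x \<sqsubseteq>\<^bsub>Hom Q (fst p) (ty A a)\<^esub> snd p (a, ())" and a': "a' \<in> objs A"
      have 1: "Comp Q (fst p) (ty A a) (ty A a') (hom A a' a) x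
          \<sqsubseteq>\<^bsub>Hom Q (fst p) (ty A a')\<^esub> Comp Q (fst p) (ty A a) (ty A a') (hom A a' a) (snd p (a, ()))"
        using a a' x C by (intro Comp_mono le le_refl) (auto intro: closed)
      have 2: "Comp Q (fst p) (ty A a) (ty A a') (hom A a' a) (snd p (a, ()))
          \<sqsubseteq>\<^bsub>Hom Q (fst p) (ty A a')\<^esub> snd p (a', ())"
        using distributor.left_action[OF dist, of "()" a a'] a a' by simp
      show "Comp Q (fst p) (ty A a) (ty A a') (hom A a' a) x \<sqsubseteq>\<^bsub>Hom Q (fst p) (ty A a')\<^esub> snd p (a', ())"
        by (rule le_trans[OF _ _ _ _ _ 1 2]) (use a a' x C in \<open>auto intro!: closed\<close>)
    qed
    then show "x \<sqsubseteq>\<^bsub>Hom Q (fst p) (ty A a)\<^esub> hom (PSh Q A) (yoneda A a) p \<longleftrightarrow>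
        x \<sqsubseteq>\<^bsub>Hom Q (fst p) (ty A a)\<^esub> snd p (a, ())"
      using le_hom_PSh_iff[OF Q p Y(1), of x] x Y(2,3) by simp
  qed (use a C hom_PSh_closed[OF Q p Y(1)] Y(2) in \<open>auto intro: closed\<close>)
qed

text \<open>
  By the Yoneda lemma, a \<open>\<phi>\<close>-weighted colimit of \<open>Y\<close> and \<open>\<phi>\<close> itself satisfy the same universal
  property: every presheaf is the colimit of representables weighted by itself.
\<close>

lemma yoneda_density:
  assumes A: "qcategory Q A" and p: "p \<in> objs (PSh Q A)"
  shows "colim_obj Q A (PSh Q A) (fst p) (\<lambda>a. snd p (a, ())) (yoneda A) p"
proof -
  interpret qcategory Q A by fact
  show ?thesis
    unfolding colim_obj_def
    by (simp add: p le_hom_PSh_iff[OF quantaloid_axioms _ p] yoneda_lemma[OF A])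
qed

text \<open>\<open>B(F-,b)\<close> is the colimit of representables weighted by itself.\<close>

lemma nerve_is_lan:
  assumes F: "qfunctor Q A B F"
  shows "is_lan Q A (PSh Q A) B (yoneda A) F (nerve A B F)"
proof (rule is_lan_colim)
  have A: "qcategory Q A" using F by (simp add: qfunctor_def)
  show Y: "qfunctor Q A (PSh Q A) (yoneda A)" using A by (rule yoneda_functor)
  show "qfunctor Q A B F" by fact
  have "colim_obj Q A (PSh Q A) (ty B b) (\<lambda>a. hom B (F a) b) (yoneda A) (nerve A B F b)"
    if "b \<in> objs B" for b
    using yoneda_density[OF A nerve_objs[OF F that]] by (simp add: colim_obj_def)
  then show "is_colim Q B A (PSh Q A) (conjoint A B F) (yoneda A) (nerve A B F)"
    using is_colim_conjoint_iff[OF Y F] by blast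
qed

section \<open>Kan extension along the Yoneda embedding\<close>

lemma is_colim_star_iff:
  assumes "qfunctor Q A B F" "p \<in> objs (PSh Q A)"
  shows "is_colim Q (star Q (fst p)) A B (snd p) F L \<longleftrightarrow>
    colim_obj Q A B (fst p) (\<lambda>a. snd p (a, ())) F (L ())"
  using assms by (simp add: is_colim_iff objs_PSh_iff)

lemma is_colim_yoneda_iff:
  assumes F: "qfunctor Q A B F"
  shows "is_colim Q (PSh Q A) A B (conjoint A (PSh Q A) (yoneda A)) F K \<longleftrightarrow>
    (\<forall>p\<in>objs (PSh Q A). colim_obj Q A B (fst p) (\<lambda>a. snd p (a, ())) F (K p))"
proof -
  have A: "qcategory Q A" using F by (simp add: qfunctor_def)
  show ?thesis
    unfolding is_colim_conjoint_iff[OF F yoneda_functor[OF A]]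
    by (simp add: colim_obj_def yoneda_lemma[OF A])
qed

text \<open>
  Being the colimit is invariant under isomorphism, and Kan extensions are unique up to isomorphism.
\<close>

lemma pointwise_lan_is_colim:
  assumes "is_pointwise_lan Q A B C F G K"
  shows "is_colim Q C A B (conjoint A C G) F K"
proof -
  have K: "is_lan Q A B C F G K" using assms by (simp add: is_pointwise_lan_def)
  then have F: "qfunctor Q A B F" and G: "qfunctor Q A C G" by (simp_all add: is_lan_def)
  obtain L where L: "is_colim Q C A B (conjoint A C G) F L"
    using assms unfolding is_pointwise_lan_def by blast
  have L_lan: "is_lan Q A B C F G L" by (rule is_lan_colim[OF F G L])
  interpret K: qfunctor Q C B K using K by (simp add: is_lan_def)
  have B: "qcategory Q B" using F by (simp add: qfunctor_def)
  show ?thesis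
    unfolding is_colim_conjoint_iff[OF F G]
  proof
    fix c assume c: "c \<in> objs C"
    show "colim_obj Q A B (ty C c) (\<lambda>a. hom C (G a) c) F (K c)"
    proof (rule colim_obj_iso[OF _ B])
      show "colim_obj Q A B (ty C c) (\<lambda>a. hom C (G a) c) F (L c)"
        using L c is_colim_conjoint_iff[OF F G] by blast
      show "Id Q (ty C c) \<sqsubseteq>\<^bsub>Hom Q (ty C c) (ty C c)\<^esub> hom B (L c) (K c)"
        using is_lan_unique[OF L_lan K] c by (simp add: functor_le_def)
      show "Id Q (ty C c) \<sqsubseteq>\<^bsub>Hom Q (ty C c) (ty C c)\<^esub> hom B (K c) (L c)"
        using is_lan_unique[OF K L_lan] c by (simp add: functor_le_def)
    qed (use c K.maps K.ty_preserving in auto)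
  qed
qed

lemma pointwise_lan_yoneda_iff:
  assumes F: "qfunctor Q A B F"
  shows "is_pointwise_lan Q A B (PSh Q A) F (yoneda A) K \<longleftrightarrow>
    (\<forall>p\<in>objs (PSh Q A). colim_obj Q A B (fst p) (\<lambda>a. snd p (a, ())) F (K p))"
proof -
  have A: "qcategory Q A" using F by (simp add: qfunctor_def)
  have "is_pointwise_lan Q A B (PSh Q A) F (yoneda A) K \<longleftrightarrow>
      is_colim Q (PSh Q A) A B (conjoint A (PSh Q A) (yoneda A)) F K"
  proof
    assume colim: "is_colim Q (PSh Q A) A B (conjoint A (PSh Q A) (yoneda A)) F K"
    then show "is_pointwise_lan Q A B (PSh Q A) F (yoneda A) K"
      using is_lan_colim[OF F yoneda_functor[OF A]] unfolding is_pointwise_lan_def by blast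
  qed (rule pointwise_lan_is_colim)
  then show ?thesis by (simp add: is_colim_yoneda_iff[OF F])
qed

text \<open>
  The colimits indexed by the single presheaves need only be chosen: functoriality of the choice
  is automatic.
\<close>

lemma pointwise_lan_yoneda_exists_iff:
  assumes F: "qfunctor Q A B F"
  shows "(\<exists>K. is_pointwise_lan Q A B (PSh Q A) F (yoneda A) K) \<longleftrightarrow>
    (\<forall>p\<in>objs (PSh Q A). \<exists>L. is_colim Q (star Q (fst p)) A B (snd p) F L)"
proof -
  have "(\<exists>L. is_colim Q (star Q (fst p)) A B (snd p) F L) \<longleftrightarrow>
      (\<exists>k. colim_obj Q A B (fst p) (\<lambda>a. snd p (a, ())) F k)" if "p \<in> objs (PSh Q A)" for p
    unfolding is_colim_star_iff[OF F that]
  proof (intro iffI; elim exE)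
    fix k assume "colim_obj Q A B (fst p) (\<lambda>a. snd p (a, ())) F k"
    then show "\<exists>L. colim_obj Q A B (fst p) (\<lambda>a. snd p (a, ())) F (L ())"
      by (intro exI[of _ "\<lambda>_. k"])
  qed blast
  then show ?thesis
    unfolding pointwise_lan_yoneda_iff[OF F] by (simp add: bchoice_iff)
qed

text \<open>
  The \<open>\<phi>\<close>-weighted colimit of \<open>F\<close> is precisely an object representing \<open>b \<mapsto> PA(\<phi>, B(F-,b))\<close>.
\<close>

lemma pointwise_lan_yoneda_left_adjoint:
  assumes F: "qfunctor Q A B F" and K: "is_pointwise_lan Q A B (PSh Q A) F (yoneda A) K"
  shows "left_adjoint Q (PSh Q A) B K (nerve A B F)"
proof -
  interpret F: qfunctor Q A B F by fact
  have A: "qcategory Q A" and B: "qcategory Q B" using F by (simp_all add: qfunctor_def)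
  have colim: "colim_obj Q A B (fst p) (\<lambda>a. snd p (a, ())) F (K p)" if "p \<in> objs (PSh Q A)" for p
    using K that pointwise_lan_yoneda_iff[OF F] by blast
  have K_fun: "qfunctor Q (PSh Q A) B K" using K by (simp add: is_pointwise_lan_def is_lan_def)
  interpret K: qfunctor Q "PSh Q A" B K by fact
  have "functor_le Q (PSh Q A) (PSh Q A) id (nerve A B F \<circ> K)"
    unfolding functor_le_def
  proof
    fix p assume p: "p \<in> objs (PSh Q A)"
    then have C: "fst p \<in> Obj Q" by (simp add: objs_PSh_iff)
    have "snd p (a, ()) \<sqsubseteq>\<^bsub>Hom Q (fst p) (ty A a)\<^esub> hom B (F a) (K p)" if "a \<in> objs A" for a
      using colim_obj_unit[OF colim[OF p] B A PSh_closed[OF p] that] .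
    then show "Id Q (ty (PSh Q A) p) \<sqsubseteq>\<^bsub>Hom Q (ty (PSh Q A) p) (ty (PSh Q A) p)\<^esub>
        hom (PSh Q A) (id p) ((nerve A B F \<circ> K) p)"
      using le_hom_PSh_nerve_iff[OF F K.maps[OF p] p, of "Id Q (fst p)"] K.ty_preserving[OF p] C p
      by (simp add: F.dom.Id_closed F.dom.Comp_Id_right F.dom.ty_closed PSh_closed)
  qed
  moreover have "functor_le Q B B (K \<circ> nerve A B F) id"
    unfolding functor_le_def
  proof
    fix b assume b: "b \<in> objs B"
    have colim_b: "colim_obj Q A B (ty B b) (\<lambda>a. hom B (F a) b) F (K (nerve A B F b))"
      using colim[OF nerve_objs[OF F b]] by (simp add: colim_obj_def)
    show "Id Q (ty B b) \<sqsubseteq>\<^bsub>Hom Q (ty B b) (ty B b)\<^esub> hom B ((K \<circ> nerve A B F) b) (id b)"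
      using colim_obj_le_iff[OF colim_b B A b refl F.hom_closed'(1)[OF _ b]] F.hom_closed'(1)[OF _ b] b
      by (simp add: F.dom.le_refl F.dom.ty_closed F.cod.ty_closed)
  qed
  ultimately show ?thesis
    using K_fun nerve_functor[OF F] by (simp add: left_adjoint_def)
qed

lemma left_adjoint_iso:
  assumes adj: "left_adjoint Q A B F G" and G': "qfunctor Q B A G'"
    and le: "functor_le Q B A G G'" "functor_le Q B A G' G"
  shows "left_adjoint Q A B F G'"
proof -
  have F: "qfunctor Q A B F" and G: "qfunctor Q B A G"
    and unit: "functor_le Q A A id (G \<circ> F)" and counit: "functor_le Q B B (F \<circ> G) id"
    using adj by (auto simp: left_adjoint_def)
  have A: "qcategory Q A" and B: "qcategory Q B" using F by (simp_all add: qfunctor_def)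
  have "functor_le Q A A (G \<circ> F) (G' \<circ> F)"
    unfolding functor_le_def
  proof
    fix a assume "a \<in> objs A"
    then show "Id Q (ty A a) \<sqsubseteq>\<^bsub>Hom Q (ty A a) (ty A a)\<^esub> hom A ((G \<circ> F) a) ((G' \<circ> F) a)"
      using le(1) qfunctor.maps[OF F] qfunctor.ty_preserving[OF F] by (fastforce simp: functor_le_def)
  qed
  then have "functor_le Q A A id (G' \<circ> F)"
    using functor_le_trans[OF qfunctor_id[OF A] qfunctor_comp[OF F G] qfunctor_comp[OF F G'] unit] by blast
  moreover have "functor_le Q B B (F \<circ> G') id"
    using functor_le_trans[OF qfunctor_comp[OF G' F] qfunctor_comp[OF G F] qfunctor_id[OF B]
        functor_le_whisker[OF F G' G le(2)] counit] .
  ultimately show ?thesis using F G' by (simp add: left_adjoint_def)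
qed

lemma pointwise_lan_yoneda_factorizes:
  assumes F: "qfunctor Q A B F" and K: "is_pointwise_lan Q A B (PSh Q A) F (yoneda A) K"
  shows "functor_iso Q A B (K \<circ> yoneda A) F"
proof -
  interpret F: qfunctor Q A B F by fact
  have A: "qcategory Q A" and B: "qcategory Q B" using F by (simp_all add: qfunctor_def)
  have "functor_le Q A B (K \<circ> yoneda A) F"
    unfolding functor_le_def
  proof
    fix a assume a: "a \<in> objs A"
    have Y: "yoneda A a \<in> objs (PSh Q A)"
      using nerve_objs[OF qfunctor_id[OF A] a] by (simp add: yoneda_eq_nerve)
    have colim: "colim_obj Q A B (ty A a) (\<lambda>a'. hom A a' a) F (K (yoneda A a))"
      using K Y pointwise_lan_yoneda_iff[OF F, of K]
      by (fastforce simp: colim_obj_def yoneda_eq_nerve)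
    show "Id Q (ty A a) \<sqsubseteq>\<^bsub>Hom Q (ty A a) (ty A a)\<^esub> hom B ((K \<circ> yoneda A) a) (F a)"
      using colim_obj_le_iff[OF colim B A F.maps[OF a] F.ty_preserving[OF a] F.dom.hom_closed[OF a]]
        F.hom_le[OF a] by simp
  qed
  then show ?thesis using K by (simp add: functor_iso_def is_pointwise_lan_def is_lan_def)
qed

lemma functor_iso_hom_eq:
  assumes "functor_iso Q A B F G" "qfunctor Q A B F" "qfunctor Q A B G" "a \<in> objs A" "b \<in> objs B"
  shows "hom B (F a) b = hom B (G a) b"
proof -
  interpret F: qfunctor Q A B F by fact
  interpret G: qfunctor Q A B G by fact
  show ?thesis
  proof (rule F.dom.le_antisym)
    show "hom B (F a) b \<sqsubseteq>\<^bsub>Hom Q (ty B b) (ty A a)\<^esub> hom B (G a) b"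
      "hom B (G a) b \<sqsubseteq>\<^bsub>Hom Q (ty B b) (ty A a)\<^esub> hom B (F a) b"
      using assms functor_leD(2)[of Q A B F G a b] functor_leD(2)[of Q A B G F a b]
      by (simp_all add: functor_iso_def)
  qed (use assms in \<open>auto intro: F.dom.ty_closed F.cod.ty_closed F.hom_closed' G.hom_closed'\<close>)
qed

text \<open>
  Cocontinuity forces the value at each presheaf, since every presheaf is a colimit of
  representables. Only weights from the one-object categories \<open>*\<^sub>C\<close> to \<open>A\<close> are involved.
\<close>

lemma cocontinuous_factorization_unique:
  fixes A :: "('a, 'o, 'm) qcat" and B :: "('b, 'o, 'm) qcat"
  assumes F: "qfunctor Q A B F" and K: "is_pointwise_lan Q A B (PSh Q A) F (yoneda A) K"
    and G: "cocontinuous TYPE(unit) TYPE('a) Q (PSh Q A) B G"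
    and iso: "functor_iso Q A B (G \<circ> yoneda A) F"
  shows "functor_iso Q (PSh Q A) B G K"
proof -
  have A: "qcategory Q A" and B: "qcategory Q B" using F by (simp_all add: qfunctor_def)
  have Y: "qfunctor Q A (PSh Q A) (yoneda A)" using A by (rule yoneda_functor)
  have G_fun: "qfunctor Q (PSh Q A) B G" using G by (simp add: cocontinuous_def)
  interpret G: qfunctor Q "PSh Q A" B G by fact
  have GY: "qfunctor Q A B (G \<circ> yoneda A)" by (rule qfunctor_comp[OF Y G_fun])
  have Gp: "colim_obj Q A B (fst p) (\<lambda>a. snd p (a, ())) F (G p)" if p: "p \<in> objs (PSh Q A)" for p
  proof -
    have "is_colim Q (star Q (fst p)) A (PSh Q A) (snd p) (yoneda A) (\<lambda>_. p)"
      using is_colim_star_iff[OF Y p] yoneda_density[OF A p] by blast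
    then obtain L where L: "is_colim Q (star Q (fst p)) A B (snd p) (G \<circ> yoneda A) L"
      and L_iso: "functor_iso Q (star Q (fst p)) B L (G \<circ> (\<lambda>_. p))"
      using G unfolding cocontinuous_def by blast
    have "colim_obj Q A B (fst p) (\<lambda>a. snd p (a, ())) (G \<circ> yoneda A) (G p)"
    proof (rule colim_obj_iso[OF _ B])
      show "colim_obj Q A B (fst p) (\<lambda>a. snd p (a, ())) (G \<circ> yoneda A) (L ())"
        using L is_colim_star_iff[OF GY p] by blast
    qed (use L_iso p in \<open>auto simp: functor_iso_def functor_le_def G.maps G.ty_preserving\<close>)
    then show ?thesis
      using functor_iso_hom_eq[OF iso GY F] by (simp add: colim_obj_def)
  qed
  have Kp: "colim_obj Q A B (fst p) (\<lambda>a. snd p (a, ())) F (K p)" if p: "p \<in> objs (PSh Q A)" for p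
    using K p pointwise_lan_yoneda_iff[OF F] by blast
  show ?thesis
    unfolding functor_iso_def functor_le_def ty_PSh
    using colim_obj_unique[OF Gp Kp B A PSh_closed] colim_obj_unique[OF Kp Gp B A PSh_closed] by blast
qed

theorem proposition6p9:
  fixes Q :: "('o, 'm) quantaloid"
    and A :: "('a, 'o, 'm) qcat"
    and B :: "('b, 'o, 'm) qcat"
    and F :: "'a \<Rightarrow> 'b"
  assumes "quantaloid Q"
    and "qcategory Q A"
    and "qcategory Q B"
    and "qfunctor Q A B F"
  shows "((\<exists>K. is_pointwise_lan Q A B (PSh Q A) F (yoneda A) K) \<longleftrightarrow>
            (\<forall>(C, \<phi>) \<in> objs (PSh Q A). \<exists>L. is_colim Q (star Q C) A B \<phi> F L)) \<and>
         (\<forall>K. is_pointwise_lan Q A B (PSh Q A) F (yoneda A) K \<longrightarrow>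
            (\<exists>R. is_lan Q A (PSh Q A) B (yoneda A) F R) \<and>
            (\<forall>R. is_lan Q A (PSh Q A) B (yoneda A) F R \<longrightarrow> left_adjoint Q (PSh Q A) B K R) \<and>
            functor_iso Q A B (K \<circ> yoneda A) F \<and>
            cocontinuous TYPE('c) TYPE('d) Q (PSh Q A) B K \<and>
            (\<forall>G. cocontinuous TYPE(unit) TYPE('a) Q (PSh Q A) B G \<longrightarrow>
                 functor_iso Q A B (G \<circ> yoneda A) F \<longrightarrow>
                 functor_iso Q (PSh Q A) B G K))"
proof (intro conjI allI impI)
  note F = \<open>qfunctor Q A B F\<close>
  show "(\<exists>K. is_pointwise_lan Q A B (PSh Q A) F (yoneda A) K) \<longleftrightarrow>
      (\<forall>(C, \<phi>) \<in> objs (PSh Q A). \<exists>L. is_colim Q (star Q C) A B \<phi> F L)"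
    unfolding pointwise_lan_yoneda_exists_iff[OF F] by (auto simp: case_prod_beta)
  show "\<exists>R. is_lan Q A (PSh Q A) B (yoneda A) F R"
    using nerve_is_lan[OF F] by blast
  fix K assume K: "is_pointwise_lan Q A B (PSh Q A) F (yoneda A) K"
  have adj: "left_adjoint Q (PSh Q A) B K (nerve A B F)"
    by (rule pointwise_lan_yoneda_left_adjoint[OF F K])
  show "left_adjoint Q (PSh Q A) B K R" if R: "is_lan Q A (PSh Q A) B (yoneda A) F R" for R
    using left_adjoint_iso[OF adj _ is_lan_unique[OF nerve_is_lan[OF F] R]
        is_lan_unique[OF R nerve_is_lan[OF F]]] R
    by (simp add: is_lan_def)
  show "functor_iso Q A B (K \<circ> yoneda A) F"
    by (rule pointwise_lan_yoneda_factorizes[OF F K])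
  show "cocontinuous TYPE('c) TYPE('d) Q (PSh Q A) B K"
    by (rule left_adjoint_cocontinuous[OF adj])
  show "functor_iso Q (PSh Q A) B G K"
    if "cocontinuous TYPE(unit) TYPE('a) Q (PSh Q A) B G" "functor_iso Q A B (G \<circ> yoneda A) F" for G
    using that by (rule cocontinuous_factorization_unique[OF F K])
qed

end
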